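(* Let $d\geq 2$ be an integer and let $q$ be a prime power. Then there exists a sequence of lattices $\mathfrak{x}_k\in[\mathcal{L}_d]$ such that (1) $[A]\mathfrak{x}_k$ is compact for every $k$, and (2) for every choice of $a_k\in[A]$, any limit point $\mathfrak{x}\in[\mathcal{L}_d]$ of the sequence $(a_k\mathfrak{x}_k)_k$ (that is, the limit of a convergent subsequence) satisfies $\mathfrak{x}\in[A][\mathcal{R}^d]$.
   Context: Let $\mathcal{R}=\mathbb{F}_q[x]$, $\mathcal{K}=\mathbb{F}_q(x)$, with absolute value $|f/g|=q^{\deg f-\deg g}$, and let $\tilde{\mathcal{K}}=\mathbb{F}_q((x^{-1}))$ be the completion. Let $G=\operatorname{GL}_d(\tilde{\mathcal{K}})$, $\Gamma=\operatorname{GL}_d(\mathcal{R})$, $[G]=\operatorname{PGL}_d(\tilde{\mathcal{K}})=G/\tilde{\mathcal{K}}^*I$, and let $[\Gamma]$ be the image of $\Gamma$ in $[G]$. The space $[\mathcal{L}_d]=[G]/[\Gamma]$ (quotient topology) is identified with the space of lattices $g\mathcal{R}^d\subseteq\tilde{\mathcal{K}}^d$, $g\in G$, up to homothety (multiplication by $\tilde{\mathcal{K}}^*$). $[A]$ is the group of (images in $[G]$ of) invertible diagonal matrices, acting on $[\mathcal{L}_d]$ by left multiplication. $[\mathcal{R}^d]$ is the homothety class of the standard lattice $\mathcal{R}^d$. *)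

theory Defs
  imports
    "HOL-Analysis.Analysis"
    "HOL-Computational_Algebra.Formal_Laurent_Series"
    "HOL-Algebra.Coset"
begin

unbundle no Formal_Power_Series.fps_syntax

section \<open>The ring \<open>F[x]\<close> inside \<open>F((1/x))\<close>\<close>

text \<open>
  The completion of \<open>F(x)\<close> at infinity is the field of formal Laurent series over \<open>F\<close> in the
  variable \<open>1/x\<close>. It is represented by the library type \<open>'a fls\<close>, where \<^term>\<open>fls_X\<close> stands
  for \<open>1/x\<close> and \<^term>\<open>fls_X_inv\<close> for \<open>x\<close>. The library metric on this type uses the
  absolute value with base 2 in place of the cardinality of \<open>F\<close>; the topology is the same.
\<close>

definition polys :: "'a::field fls set" where
  "polys = range (\<lambda>p. poly (map_poly fls_const p) fls_X_inv)"


section \<open>Quotient topology\<close>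

definition quotient_topology :: "'a topology \<Rightarrow> ('a \<Rightarrow> 'b) \<Rightarrow> 'b topology" where
  "quotient_topology X f =
     topology (\<lambda>U. U \<subseteq> f ` topspace X \<and> openin X {x \<in> topspace X. f x \<in> U})"

lemma openin_quotient_topology:
  fixes X :: "'a topology" and f :: "'a \<Rightarrow> 'b"
  shows
  "openin (quotient_topology X f) U \<longleftrightarrow>
     U \<subseteq> f ` topspace X \<and> openin X {x \<in> topspace X. f x \<in> U}"
proof -
  have "istopology (\<lambda>U. U \<subseteq> f ` topspace X \<and> openin X {x \<in> topspace X. f x \<in> U})"
    unfolding istopology_def
  proof (intro conjI allI impI)
    fix S T
    assume S: "S \<subseteq> f ` topspace X \<and> openin X {x \<in> topspace X. f x \<in> S}"
      and T: "T \<subseteq> f ` topspace X \<and> openin X {x \<in> topspace X. f x \<in> T}"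
    show "S \<inter> T \<subseteq> f ` topspace X" using S by blast
    have "{x \<in> topspace X. f x \<in> S \<inter> T} =
      {x \<in> topspace X. f x \<in> S} \<inter> {x \<in> topspace X. f x \<in> T}" by blast
    then show "openin X {x \<in> topspace X. f x \<in> S \<inter> T}" using S T by auto
  next
    fix K :: "'b set set"
    assume K: "\<forall>U\<in>K. U \<subseteq> f ` topspace X \<and> openin X {x \<in> topspace X. f x \<in> U}"
    then show "\<Union>K \<subseteq> f ` topspace X" by blast
    have "{x \<in> topspace X. f x \<in> \<Union>K} = (\<Union>U\<in>K. {x \<in> topspace X. f x \<in> U})" by blast
    then show "openin X {x \<in> topspace X. f x \<in> \<Union>K}" using K by auto
  qed
  then show ?thesis by (simp add: quotient_topology_def)
qed

lemma topspace_quotient_topology [simp]: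
  "topspace (quotient_topology X f) = f ` topspace X"
proof
  show "topspace (quotient_topology X f) \<subseteq> f ` topspace X"
    using openin_topspace[of "quotient_topology X f"] by (simp only: openin_quotient_topology)
  have "{x \<in> topspace X. f x \<in> f ` topspace X} = topspace X" by blast
  then have "openin (quotient_topology X f) (f ` topspace X)"
    by (simp add: openin_quotient_topology)
  then show "f ` topspace X \<subseteq> topspace (quotient_topology X f)"
    by (rule openin_subset)
qed

lemma quotient_map_quotient_topology: "quotient_map X (quotient_topology X f) f"
  by (simp add: quotient_map_def openin_quotient_topology)


section \<open>The groups \<open>GL\<^sub>d\<close> and \<open>PGL\<^sub>d\<close>, and the images of \<open>GL\<^sub>d(F[x])\<close> and of the diagonal group\<close>

definition GL :: "('a::field fls ^ 'n ^ 'n) monoid" where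
  "GL = \<lparr>carrier = {g. invertible g}, mult = (**), one = mat 1\<rparr>"

definition scalars :: "('a::field fls ^ 'n ^ 'n) set" where
  "scalars = {mat c | c. c \<noteq> 0}"

definition PGL :: "('a::field fls ^ 'n ^ 'n) set monoid" where
  "PGL = GL Mod scalars"

definition proj :: "'a::field fls ^ 'n ^ 'n \<Rightarrow> ('a fls ^ 'n ^ 'n) set" where
  "proj g = scalars #>\<^bsub>GL\<^esub> g"

definition PGL_topology :: "('a::field fls ^ 'n ^ 'n) set topology" where
  "PGL_topology = quotient_topology (subtopology euclidean (carrier GL)) proj"

definition GL_polys :: "('a::field fls ^ 'n ^ 'n) set" where
  "GL_polys = {g. (\<forall>i j. g $ i $ j \<in> polys) \<and>
     (\<exists>h. (\<forall>i j. h $ i $ j \<in> polys) \<and> g ** h = mat 1 \<and> h ** g = mat 1)}"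

definition PGamma :: "('a::field fls ^ 'n ^ 'n) set set" where
  "PGamma = proj ` GL_polys"

definition PDiag :: "('a::field fls ^ 'n ^ 'n) set set" where
  "PDiag = proj ` {g. invertible g \<and> (\<forall>i j. i \<noteq> j \<longrightarrow> g $ i $ j = 0)}"


section \<open>The space of lattices up to homothety\<close>

definition standard_lattice :: "('a::field fls ^ 'n) set" where
  "standard_lattice = {v. \<forall>i. v $ i \<in> polys}"

definition homothety_class :: "('a::field fls ^ 'n) set \<Rightarrow> ('a fls ^ 'n) set set" where
  "homothety_class L = {(\<lambda>v. c *s v) ` L | c. c \<noteq> 0}"

definition lattice_classes :: "('a::field fls ^ 'n) set set set" where
  "lattice_classes = {homothety_class ((\<lambda>v. g *v v) ` standard_lattice) | g. g \<in> carrier GL}"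

text \<open>
  For \<open>X\<close> the homothety class of \<open>L\<close>, the action of the class of \<open>g\<close> on \<open>X\<close> is the homothety
  class of \<open>g L\<close>.
\<close>

definition act ::
  "('a::field fls ^ 'n ^ 'n) set \<Rightarrow> ('a fls ^ 'n) set set \<Rightarrow> ('a fls ^ 'n) set set" where
  "act P X = {(\<lambda>v. g *v v) ` L | g L. g \<in> P \<and> L \<in> X}"

text \<open>
  The topology is the quotient topology of \<open>PGL\<^sub>d\<close> modulo the image of \<open>GL\<^sub>d(F[x])\<close>, transported to
  lattice classes along the orbit map of the standard class. The fibres of this map are the
  left cosets of \<^const>\<open>PGamma\<close>, see \<open>act_standard_eq_iff\<close> below.
\<close>

definition lattice_topology :: "('a::field fls ^ 'n) set set topology" where
  "lattice_topology =
     quotient_topology PGL_topology (\<lambda>P. act P (homothety_class standard_lattice))"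

definition diag_orbit :: "('a::field fls ^ 'n) set set \<Rightarrow> ('a fls ^ 'n) set set set" where
  "diag_orbit X = {act a X | a. a \<in> PDiag}"


section \<open>Consistency of the definitions\<close>

lemma group_GL: "group (GL :: ('a::field fls ^ 'n ^ 'n) monoid)"
proof (rule groupI)
  fix x :: "'a fls ^ 'n ^ 'n"
  assume "x \<in> carrier GL"
  then obtain y where "x ** y = mat 1" "y ** x = mat 1"
    by (auto simp: GL_def invertible_def)
  then show "\<exists>y\<in>carrier GL. y \<otimes>\<^bsub>GL\<^esub> x = \<one>\<^bsub>GL\<^esub>"
    by (auto simp: GL_def invertible_def)
next
  show "\<one>\<^bsub>GL\<^esub> \<in> carrier GL"
    by (auto simp: GL_def invertible_def intro: exI[of _ "mat 1"])
qed (auto simp: GL_def matrix_mul_assoc invertible_mult)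

lemma mat_mult_component: "(mat c ** g) $ i $ j = c * g $ i $ j" for g :: "'a::field ^ 'n ^ 'm"
  by (simp add: matrix_matrix_mult_def mat_def if_distrib[of "\<lambda>x. x * _"] cong: if_cong)

lemma mult_mat_component: "(g ** mat c) $ i $ j = g $ i $ j * c" for g :: "'a::field ^ 'n ^ 'm"
  by (simp add: matrix_matrix_mult_def mat_def if_distrib[of "\<lambda>x. _ * x"] cong: if_cong)

lemma mat_commute: "mat c ** g = g ** mat c" for g :: "'a::field ^ 'n ^ 'n"
  by (simp add: vec_eq_iff mat_mult_component mult_mat_component)

lemma mat_mult_mat: "mat c ** mat d = (mat (c * d) :: 'a::field ^ 'n ^ 'n)"
  by (simp add: vec_eq_iff mat_mult_component) (simp add: mat_def)

lemma mat_mult_vec: "mat c *v v = c *s v" for v :: "'a::field ^ 'n"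
  by (simp add: vec_eq_iff matrix_vector_mult_def mat_def if_distrib[of "\<lambda>x. x * _"] cong: if_cong)

lemma invertible_mat: "c \<noteq> 0 \<Longrightarrow> invertible (mat c :: 'a::field ^ 'n ^ 'n)"
  unfolding invertible_def by (rule exI[of _ "mat (inverse c)"]) (simp add: mat_mult_mat)

lemma normal_scalars: "scalars \<lhd> (GL :: ('a::field fls ^ 'n ^ 'n) monoid)"
proof -
  interpret group "GL :: ('a fls ^ 'n ^ 'n) monoid" by (rule group_GL)
  have sub: "subgroup scalars (GL :: ('a fls ^ 'n ^ 'n) monoid)"
  proof (rule subgroupI)
    show "scalars \<subseteq> carrier (GL :: ('a fls ^ 'n ^ 'n) monoid)"
      by (auto simp: scalars_def GL_def invertible_mat)
    show "(scalars :: ('a fls ^ 'n ^ 'n) set) \<noteq> {}"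
      by (auto simp: scalars_def intro: exI[of _ 1])
  next
    fix a :: "'a fls ^ 'n ^ 'n"
    assume "a \<in> scalars"
    then obtain c where c: "a = mat c" "c \<noteq> 0" by (auto simp: scalars_def)
    have "inv\<^bsub>GL\<^esub> a = mat (inverse c)"
      using c by (intro inv_equality) (auto simp: GL_def mat_mult_mat invertible_mat)
    then show "inv\<^bsub>GL\<^esub> a \<in> scalars" using c by (auto simp: scalars_def)
  next
    fix a b :: "'a fls ^ 'n ^ 'n"
    assume "a \<in> scalars" "b \<in> scalars"
    then show "a \<otimes>\<^bsub>GL\<^esub> b \<in> scalars"
      by (auto simp: scalars_def GL_def mat_mult_mat)
  qed
  show ?thesis
    by (rule normalI[OF sub])
       (auto simp: r_coset_def l_coset_def scalars_def GL_def, (metis mat_commute)+)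
qed

lemma group_PGL: "group (PGL :: ('a::field fls ^ 'n ^ 'n) set monoid)"
  unfolding PGL_def by (rule normal.factorgroup_is_group[OF normal_scalars])

lemma carrier_PGL: "carrier PGL = proj ` carrier GL"
  by (auto simp: PGL_def carrier_FactGroup proj_def)

lemma proj_mult:
  assumes "g \<in> carrier GL" "h \<in> carrier GL"
  shows "proj g \<otimes>\<^bsub>PGL\<^esub> proj h = proj (g ** h)"
  using normal.rcos_sum[OF normal_scalars assms]
  by (simp add: PGL_def proj_def GL_def)

lemma proj_alt: "proj g = {mat c ** g | c. c \<noteq> 0}"
  by (auto simp: proj_def r_coset_def scalars_def GL_def)

lemma proj_eq_iff: "proj g = proj h \<longleftrightarrow> (\<exists>c. c \<noteq> 0 \<and> h = mat c ** g)"
proof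
  assume "proj g = proj h"
  moreover have "h \<in> proj h" by (auto simp: proj_alt intro: exI[of _ 1])
  ultimately show "\<exists>c. c \<noteq> 0 \<and> h = mat c ** g" by (auto simp: proj_alt)
next
  assume "\<exists>c. c \<noteq> 0 \<and> h = mat c ** g"
  then obtain c where c: "c \<noteq> 0" "h = mat c ** g" by auto
  show "proj g = proj h"
  proof (intro equalityI subsetI)
    fix y assume "y \<in> proj g"
    then obtain d where "d \<noteq> 0" "y = mat d ** g" by (auto simp: proj_alt)
    then have "d / c \<noteq> 0 \<and> y = mat (d / c) ** h"
      using c by (simp add: matrix_mul_assoc mat_mult_mat)
    then show "y \<in> proj h" by (auto simp: proj_alt)
  next
    fix y assume "y \<in> proj h"
    then obtain d where "d \<noteq> 0" "y = mat d ** h" by (auto simp: proj_alt)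
    then have "d * c \<noteq> 0 \<and> y = mat (d * c) ** g"
      using c by (simp add: matrix_mul_assoc mat_mult_mat)
    then show "y \<in> proj g" by (auto simp: proj_alt)
  qed
qed

lemma act_proj: "act (proj g) (homothety_class L) = homothety_class ((\<lambda>v. g *v v) ` L)"
proof (intro equalityI subsetI)
  fix M assume "M \<in> act (proj g) (homothety_class L)"
  then obtain c d where cd: "c \<noteq> 0" "d \<noteq> 0"
    and M: "M = (\<lambda>v. (mat c ** g) *v v) ` ((\<lambda>v. d *s v) ` L)"
    by (auto simp: act_def proj_alt homothety_class_def)
  have "(mat c ** g) *v (d *s v) = (c * d) *s (g *v v)" for v
    by (simp flip: matrix_vector_mul_assoc add: mat_mult_vec vector_scalar_commute)
  then have "M = (\<lambda>v. (c * d) *s v) ` ((\<lambda>v. g *v v) ` L)"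
    by (simp add: M image_image)
  then show "M \<in> homothety_class ((\<lambda>v. g *v v) ` L)"
    unfolding homothety_class_def using cd by (auto intro!: exI[of _ "c * d"])
next
  fix M assume "M \<in> homothety_class ((\<lambda>v. g *v v) ` L)"
  then obtain c where c: "c \<noteq> 0" and M: "M = (\<lambda>v. c *s v) ` ((\<lambda>v. g *v v) ` L)"
    by (auto simp: homothety_class_def)
  have "M = (\<lambda>v. (mat c ** g) *v v) ` L"
    by (simp add: M image_image mat_mult_vec flip: matrix_vector_mul_assoc)
  moreover have "mat c ** g \<in> proj g" using c by (auto simp: proj_alt)
  moreover have "L \<in> homothety_class L"
    by (auto simp: homothety_class_def intro!: exI[of _ 1])
  ultimately show "M \<in> act (proj g) (homothety_class L)"
    unfolding act_def by blast
qed

lemma topspace_PGL_topology: "topspace PGL_topology = carrier PGL"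
  by (simp add: PGL_topology_def carrier_PGL)

lemma topspace_lattice_topology: "topspace lattice_topology = lattice_classes"
  by (force simp: lattice_topology_def topspace_PGL_topology carrier_PGL lattice_classes_def
      act_proj image_image)

lemma act_mult:
  assumes "P \<in> carrier PGL" "Q \<in> carrier PGL" "X \<in> lattice_classes"
  shows "act P (act Q X) = act (P \<otimes>\<^bsub>PGL\<^esub> Q) X"
proof -
  obtain g h L where "g \<in> carrier GL" "P = proj g" "h \<in> carrier GL" "Q = proj h"
    "X = homothety_class L"
    using assms by (auto simp: carrier_PGL lattice_classes_def)
  then show ?thesis
    by (simp add: proj_mult act_proj image_image matrix_vector_mul_assoc)
qed

lemma act_one:
  fixes X :: "('a::field fls ^ 'n) set set"
  assumes "X \<in> lattice_classes"
  shows "act \<one>\<^bsub>PGL\<^esub> X = X"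
proof -
  have "\<one>\<^bsub>PGL\<^esub> = proj (mat 1 :: 'a fls ^ 'n ^ 'n)"
    by (auto simp: PGL_def proj_alt scalars_def)
  moreover obtain L where "X = homothety_class L"
    using assms by (auto simp: lattice_classes_def)
  ultimately show ?thesis by (simp only: act_proj) simp
qed

lemma polys_0: "0 \<in> polys"
  unfolding polys_def by (rule range_eqI[of _ _ 0]) simp

lemma polys_1: "1 \<in> polys"
  unfolding polys_def by (rule range_eqI[of _ _ 1]) simp

lemma map_poly_fls_const:
  "map_poly fls_const (p + q) = map_poly fls_const p + map_poly fls_const q"
  "map_poly fls_const (p * q) = map_poly fls_const p * map_poly fls_const q"
  for p q :: "'a::field poly"
proof -
  show add: "map_poly fls_const (p + q) = map_poly fls_const p + map_poly fls_const q" for p q :: "'a poly"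
    by (rule poly_eqI) (simp add: coeff_map_poly flip: fls_plus_const)
  show "map_poly fls_const (p * q) = map_poly fls_const p * map_poly fls_const q"
    by (induction p)
       (simp_all add: add map_poly_pCons map_poly_smult flip: fls_const_mult_const)
qed

lemma polys_add: "a \<in> polys \<Longrightarrow> b \<in> polys \<Longrightarrow> a + b \<in> polys"
  unfolding polys_def by (auto simp flip: map_poly_fls_const poly_add)

lemma polys_mult: "a \<in> polys \<Longrightarrow> b \<in> polys \<Longrightarrow> a * b \<in> polys"
  unfolding polys_def by (auto simp flip: map_poly_fls_const poly_mult)

lemma polys_sum: "(\<And>i. i \<in> S \<Longrightarrow> f i \<in> polys) \<Longrightarrow> sum f S \<in> polys"
  by (induction S rule: infinite_finite_induct) (auto intro: polys_0 polys_add)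

lemma standard_lattice_mult:
  fixes g :: "'a::field fls ^ 'n ^ 'n"
  shows "(\<forall>i j. g $ i $ j \<in> polys) \<longleftrightarrow> (\<lambda>v. g *v v) ` standard_lattice \<subseteq> standard_lattice"
proof
  assume "\<forall>i j. g $ i $ j \<in> polys"
  then show "(\<lambda>v. g *v v) ` standard_lattice \<subseteq> standard_lattice"
    by (auto simp: standard_lattice_def matrix_vector_mult_def intro!: polys_sum polys_mult)
next
  assume sub: "(\<lambda>v. g *v v) ` standard_lattice \<subseteq> standard_lattice"
  show "\<forall>i j. g $ i $ j \<in> polys"
  proof (intro allI)
    fix i j :: 'n
    have "(axis j 1 :: 'a fls ^ 'n) \<in> standard_lattice"
      by (auto simp: standard_lattice_def axis_def polys_0 polys_1)
    then have "g *v axis j 1 \<in> standard_lattice" using sub by blast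
    moreover have "(g *v axis j 1) $ i = g $ i $ j"
      by (simp add: matrix_vector_mult_def axis_def if_distrib[of "\<lambda>x. _ * x"] cong: if_cong)
    ultimately show "g $ i $ j \<in> polys"
      by (metis (mono_tags, lifting) mem_Collect_eq standard_lattice_def)
  qed
qed

lemma GL_polys_iff:
  fixes g :: "'a::field fls ^ 'n ^ 'n"
  assumes "invertible g"
  shows "g \<in> GL_polys \<longleftrightarrow> (\<lambda>v. g *v v) ` standard_lattice = standard_lattice"
proof
  assume "g \<in> GL_polys"
  then obtain h where g: "\<forall>i j. g $ i $ j \<in> polys" and h: "\<forall>i j. h $ i $ j \<in> polys"
    and gh: "g ** h = mat 1"
    unfolding GL_polys_def by blast
  have "v \<in> (\<lambda>v. g *v v) ` standard_lattice" if v: "v \<in> standard_lattice" for v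
  proof (rule image_eqI)
    show "v = g *v (h *v v)" by (simp add: matrix_vector_mul_assoc gh)
    show "h *v v \<in> standard_lattice"
      using iffD1[OF standard_lattice_mult h] v by (rule subsetD[OF _ imageI])
  qed
  then show "(\<lambda>v. g *v v) ` standard_lattice = standard_lattice"
    using iffD1[OF standard_lattice_mult g] by (intro equalityI subsetI) (erule subsetD)
next
  assume eq: "(\<lambda>v. g *v v) ` standard_lattice = standard_lattice"
  obtain h where h: "g ** h = mat 1" "h ** g = mat 1"
    using assms by (auto simp: invertible_def)
  have sub: "(\<lambda>v. h *v v) ` standard_lattice \<subseteq> standard_lattice"
  proof (rule image_subsetI)
    fix w :: "'a fls ^ 'n" assume "w \<in> standard_lattice"
    then have "w \<in> (\<lambda>v. g *v v) ` standard_lattice" by (simp only: eq)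
    then obtain v where "v \<in> standard_lattice" "w = g *v v" by (rule imageE)
    then show "h *v w \<in> standard_lattice" by (simp add: matrix_vector_mul_assoc h)
  qed
  show "g \<in> GL_polys"
    unfolding GL_polys_def mem_Collect_eq
  proof (intro conjI exI)
    show "\<forall>i j. g $ i $ j \<in> polys" by (rule iffD2[OF standard_lattice_mult]) (simp add: eq)
    show "\<forall>i j. h $ i $ j \<in> polys" by (rule iffD2[OF standard_lattice_mult sub])
  qed (fact h)+
qed

lemma proj_coset_PGamma:
  fixes g :: "'a::field fls ^ 'n ^ 'n"
  assumes "g \<in> carrier GL"
  shows "proj g <#\<^bsub>PGL\<^esub> PGamma = {proj (g ** k) | k. k \<in> GL_polys}"
proof -
  have "k \<in> GL_polys \<Longrightarrow> k \<in> carrier GL" for k :: "'a fls ^ 'n ^ 'n"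
    by (auto simp: GL_polys_def GL_def invertible_def)
  then show ?thesis
    using assms by (force simp: l_coset_def PGamma_def proj_mult)
qed

theorem act_standard_eq_iff:
  fixes P Q :: "('a::field fls ^ 'n ^ 'n) set"
  assumes "P \<in> carrier PGL" "Q \<in> carrier PGL"
  shows "act P (homothety_class standard_lattice) = act Q (homothety_class standard_lattice) \<longleftrightarrow>
    P <#\<^bsub>PGL\<^esub> PGamma = Q <#\<^bsub>PGL\<^esub> PGamma"
proof -
  let ?L = "standard_lattice :: ('a fls ^ 'n) set"
  obtain g h where g: "g \<in> carrier GL" "P = proj g" and h: "h \<in> carrier GL" "Q = proj h"
    using assms by (auto simp: carrier_PGL)
  obtain h' where h': "h ** h' = mat 1" "h' ** h = mat 1"
    using h(1) by (auto simp: GL_def invertible_def)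
  obtain g' where g': "g ** g' = mat 1" "g' ** g = mat 1"
    using g(1) by (auto simp: GL_def invertible_def)
  have one: "mat 1 \<in> (GL_polys :: ('a fls ^ 'n ^ 'n) set)"
    unfolding GL_polys_def by (auto intro!: exI[of _ "mat 1"]) (auto simp: mat_def polys_0 polys_1)
  have GLmul: "k ** l \<in> GL_polys" if "k \<in> GL_polys" "l \<in> GL_polys" for k l :: "'a fls ^ 'n ^ 'n"
  proof -
    have inv: "invertible k" "invertible l" using that by (auto simp: GL_polys_def invertible_def)
    then have "(\<lambda>v. (k ** l) *v v) ` ?L = (\<lambda>v. k *v v) ` ((\<lambda>v. l *v v) ` ?L)"
      by (simp add: image_image matrix_vector_mul_assoc)
    also have "\<dots> = ?L" using that inv by (simp add: GL_polys_iff)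
    finally show ?thesis using inv by (simp add: GL_polys_iff invertible_mult)
  qed
  have GLinv: "\<exists>l\<in>GL_polys. k ** l = mat 1" if "k \<in> GL_polys" for k :: "'a fls ^ 'n ^ 'n"
    using that unfolding GL_polys_def by blast
  show ?thesis
  proof
    assume "act P (homothety_class ?L) = act Q (homothety_class ?L)"
    then have "homothety_class ((\<lambda>v. g *v v) ` ?L) = homothety_class ((\<lambda>v. h *v v) ` ?L)"
      by (simp add: g h act_proj)
    moreover have "(\<lambda>v. g *v v) ` ?L \<in> homothety_class ((\<lambda>v. g *v v) ` ?L)"
      unfolding homothety_class_def by (auto simp: image_image intro!: exI[of _ 1])
    ultimately obtain c where c: "c \<noteq> 0"
      and eq: "(\<lambda>v. g *v v) ` ?L = (\<lambda>v. c *s v) ` ((\<lambda>v. h *v v) ` ?L)"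
      by (auto simp: homothety_class_def)
    define k where "k = mat (inverse c) ** (h' ** g)"
    have gk: "g = mat c ** (h ** k)"
    proof -
      have "mat c ** (h ** k) = (mat c ** mat (inverse c)) ** ((h ** h') ** g)"
        unfolding k_def by (metis mat_commute matrix_mul_assoc)
      then show ?thesis using c by (simp add: h' mat_mult_mat)
    qed
    have invk: "invertible k"
    proof -
      have "invertible h'" "invertible g" "invertible (mat (inverse c) :: 'a fls ^ 'n ^ 'n)"
        using c g(1) h' by (auto simp: GL_def invertible_def intro: invertible_mat[unfolded invertible_def])
      then show ?thesis unfolding k_def by (intro invertible_mult)
    qed
    have "(\<lambda>v. k *v v) ` ?L = (\<lambda>v. (mat (inverse c) ** h') *v v) ` ((\<lambda>v. g *v v) ` ?L)"
      by (simp add: k_def image_image matrix_vector_mul_assoc matrix_mul_assoc)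
    also have "\<dots> = (\<lambda>v. (mat (inverse c) ** h') *v (c *s (h *v v))) ` ?L"
      by (simp add: eq image_image)
    also have "(\<lambda>v. (mat (inverse c) ** h') *v (c *s (h *v v))) = (\<lambda>v. v)"
    proof
      fix v
      have "(mat (inverse c) ** h') *v (c *s (h *v v)) = inverse c *s (c *s ((h' ** h) *v v))"
        by (simp add: mat_mult_vec vector_scalar_commute flip: matrix_vector_mul_assoc)
      then show "(mat (inverse c) ** h') *v (c *s (h *v v)) = v"
        using c by (simp add: h' vector_smult_assoc)
    qed
    finally have k: "k \<in> GL_polys" using invk by (simp add: GL_polys_iff)
    have pg: "proj (g ** l) = proj (h ** (k ** l))" for l
    proof -
      have "g ** l = mat c ** (h ** (k ** l))"
        by (simp add: gk matrix_mul_assoc)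
      then show ?thesis using c proj_eq_iff by metis
    qed
    obtain k' where k': "k' \<in> GL_polys" "k ** k' = mat 1" using GLinv[OF k] by blast
    have "{proj (g ** l) | l. l \<in> GL_polys} = {proj (h ** l) | l. l \<in> GL_polys}"
    proof (intro equalityI subsetI)
      fix y assume "y \<in> {proj (g ** l) | l. l \<in> GL_polys}"
      then show "y \<in> {proj (h ** l) | l. l \<in> GL_polys}" using pg GLmul[OF k] by blast
    next
      fix y assume "y \<in> {proj (h ** l) | l. l \<in> GL_polys}"
      then obtain l where l: "l \<in> GL_polys" "y = proj (h ** l)" by blast
      have "y = proj (g ** (k' ** l))"
        unfolding pg by (simp add: l matrix_mul_assoc k')
      then show "y \<in> {proj (g ** l) | l. l \<in> GL_polys}" using GLmul[OF k'(1) l(1)] by blast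
    qed
    then show "P <#\<^bsub>PGL\<^esub> PGamma = Q <#\<^bsub>PGL\<^esub> PGamma"
      by (simp add: g h proj_coset_PGamma)
  next
    assume "P <#\<^bsub>PGL\<^esub> PGamma = Q <#\<^bsub>PGL\<^esub> PGamma"
    then have "{proj (g ** l) | l. l \<in> GL_polys} = {proj (h ** l) | l. l \<in> GL_polys}"
      by (simp add: g h proj_coset_PGamma)
    moreover have "proj g \<in> {proj (g ** l) | l. l \<in> GL_polys}"
      using one by (auto intro!: exI[of _ "mat 1"])
    ultimately obtain l where l: "l \<in> GL_polys" "proj g = proj (h ** l)" by auto
    then have "invertible l" by (auto simp: GL_polys_def invertible_def)
    then have "(\<lambda>v. l *v v) ` ?L = ?L" using l(1) by (simp add: GL_polys_iff)
    moreover have "(\<lambda>v. (h ** l) *v v) ` ?L = (\<lambda>v. h *v v) ` ((\<lambda>v. l *v v) ` ?L)"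
      by (simp add: image_image matrix_vector_mul_assoc)
    ultimately show "act P (homothety_class ?L) = act Q (homothety_class ?L)"
      by (simp add: g h l(2) act_proj)
  qed
qed

end

theory Submission
  imports Defs
begin

text \<open>
  Take polynomials \<open>Q\<^sub>1, \<dots>, Q\<^sub>d\<close> whose differences all have degree between \<open>k\<close> and \<open>k + d\<close>. The
  polynomial \<open>\<Prod>\<^sub>i (Y - Q\<^sub>i) - 1\<close> splits over \<open>F((1/x))\<close>, with a root \<open>\<theta>\<^sub>l\<close> close to each \<open>Q\<^sub>l\<close>. In the
  order \<open>F[x][\<theta>]\<close>, embedded by its \<open>d\<close> evaluations, every \<open>\<theta> - Q\<^sub>i\<close> is a unit, so the diagonal orbit
  of this lattice is compact: multiplying a diagonal matrix by these units brings its entries to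
  degrees that differ by at most \<open>d k\<close>. To find the units, minimise the sum of the squares of the
  degrees (\<open>normalize_diag\<close>).

  Let now \<open>a\<close> be a diagonal matrix normalised in this way, and enumerate the coordinates by
  decreasing degree of \<open>a\<close>. The products of the first \<open>j\<close> of the \<open>\<theta> - Q\<^sub>i\<close>, for \<open>j < d\<close>, form a basis of
  the order, and after multiplication by \<open>a\<close> each basis vector is, up to a bounded error, dominated by
  its diagonal entry, while the determinant is the product of the diagonal entries. If the
  lattice is close to a fixed lattice, its covolume and the length of its shortest vectors are
  bounded, so all diagonal entries have bounded degree. This determines the degrees of \<open>a\<close> up to
  a bounded error and forces the off-diagonal entries to tend to 0 as \<open>k\<close> grows. Since \<open>F\<close> is
  finite, the base changes involved take finitely many values, and the limit lattice has
  a diagonal basis.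
\<close>

section \<open>Degrees and the topology of Laurent series\<close>

text \<open>Vanishing coefficients in place of a bound on the degree make the condition additive
  without a case distinction at 0.\<close>

definition deg_le :: "'a::field fls \<Rightarrow> int \<Rightarrow> bool" where
  "deg_le z n \<longleftrightarrow> (\<forall>i < -n. fls_nth z i = 0)"

text \<open>
  The degree in \<open>x\<close>. Beware that \<open>deg 0 = 0\<close>, whereas \<^const>\<open>deg_le\<close> treats \<open>0\<close> as having
  degree \<open>-\<infinity>\<close>.
\<close>

definition deg :: "'a::field fls \<Rightarrow> int" where
  "deg z = - fls_subdegree z"

lemma deg_le_iff: "deg_le z n \<longleftrightarrow> z = 0 \<or> deg z \<le> n"
proof -
  have "fls_nth z (fls_subdegree z) \<noteq> 0" if "z \<noteq> 0" using that by simp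
  then show ?thesis
    unfolding deg_le_def deg_def
    by (metis fls_eq0_below_subdegree fls_zero_nth linorder_not_le minus_le_iff neg_le_iff_le
        order_less_le_trans)
qed

lemma deg_leD: "deg_le z n \<Longrightarrow> z \<noteq> 0 \<Longrightarrow> deg z \<le> n"
  by (simp add: deg_le_iff)

lemma deg_le_deg: "deg_le z (deg z)"
  by (simp add: deg_le_iff)

lemma deg_le_0 [simp]: "deg_le 0 n"
  by (simp add: deg_le_def)

lemma deg_le_mono: "deg_le z m \<Longrightarrow> m \<le> n \<Longrightarrow> deg_le z n"
  by (simp add: deg_le_def)

lemma deg_le_add: "deg_le x n \<Longrightarrow> deg_le y n \<Longrightarrow> deg_le (x + y) n"
  by (simp add: deg_le_def)

lemma deg_le_diff: "deg_le x n \<Longrightarrow> deg_le y n \<Longrightarrow> deg_le (x - y) n"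
  by (simp add: deg_le_def)

lemma deg_le_uminus [simp]: "deg_le (- x) n \<longleftrightarrow> deg_le x n"
  by (simp add: deg_le_def)

lemma deg_le_sum: "(\<And>i. i \<in> S \<Longrightarrow> deg_le (f i) n) \<Longrightarrow> deg_le (sum f S) n"
  by (induction S rule: infinite_finite_induct) (auto intro: deg_le_add)

lemma deg_mult: "x \<noteq> 0 \<Longrightarrow> y \<noteq> 0 \<Longrightarrow> deg (x * y) = deg x + deg y"
  by (simp add: deg_def)

lemma deg_le_mult: "deg_le x m \<Longrightarrow> deg_le y n \<Longrightarrow> deg_le (x * y) (m + n)"
  using deg_mult[of x y] by (cases "x = 0"; cases "y = 0") (auto simp: deg_le_iff)

lemma deg_1 [simp]: "deg 1 = 0"
  by (simp add: deg_def)

lemma deg_inverse: "deg (inverse x) = - deg x"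
  by (simp add: deg_def)

lemma deg_uminus [simp]: "deg (- x) = deg x"
  by (simp add: deg_def)

lemma deg_prod: "(\<And>i. i \<in> S \<Longrightarrow> f i \<noteq> 0) \<Longrightarrow> deg (prod f S) = (\<Sum>i\<in>S. deg (f i))"
  by (induction S rule: infinite_finite_induct) (auto simp: deg_mult)

lemma deg_le_prod: "(\<And>i. i \<in> S \<Longrightarrow> deg_le (f i) (g i)) \<Longrightarrow> deg_le (prod f S) (sum g S)"
  by (induction S rule: infinite_finite_induct)
     (auto intro: deg_le_mult simp: deg_le_iff[of 1])

lemma deg_add_dominant:
  assumes "x \<noteq> 0" "deg_le y n" "n < deg x"
  shows "x + y \<noteq> 0" "deg (x + y) = deg x"
proof -
  have "x + y \<noteq> 0 \<and> deg (x + y) = deg x"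
  proof (cases "y = 0")
    case False
    then have lt: "fls_subdegree x < fls_subdegree y"
      using assms by (auto simp: deg_le_iff deg_def)
    then have "fls_subdegree (x + y) = fls_subdegree x"
      using assms by (intro fls_subdegree_add_eq1)
    moreover have "fls_nth (x + y) (fls_subdegree x) \<noteq> 0"
      using lt assms by simp
    ultimately show ?thesis by (metis deg_def fls_zero_nth)
  qed (use assms in simp)
  then show "x + y \<noteq> 0" "deg (x + y) = deg x" by auto
qed

lemma deg_le_all_imp_0: "(\<And>n. \<exists>m\<le>n. deg_le z m) \<Longrightarrow> z = 0"
  by (meson deg_leD deg_le_mono linorder_not_less lt_ex)

section \<open>Polynomials as Laurent series\<close>

lemma polys_nth: "p \<in> polys \<Longrightarrow> i > 0 \<Longrightarrow> fls_nth p i = 0"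
proof -
  assume "p \<in> polys" "i > 0"
  then obtain P where P: "p = poly (map_poly fls_const P) fls_X_inv"
    by (auto simp: polys_def)
  show ?thesis
    unfolding P using \<open>i > 0\<close>
  proof (induction P arbitrary: i)
    case (pCons a Q)
    then show ?case
      by (simp add: map_poly_pCons fls_X_inv_times_conv_shift)
  qed simp
qed

lemma polys_deg_nonneg:
  assumes "p \<in> polys" "p \<noteq> 0"
  shows "deg p \<ge> 0"
  using polys_nth[OF assms(1), of "fls_subdegree p"] assms(2) by (force simp: deg_def)

text \<open>A polynomial of bounded degree is determined by its coefficients at the indices
  \<open>- n..0\<close>, each from a finite field. The pigeonhole argument for base changes rests on
  this.\<close>

lemma finite_polys_deg_le: "finite {p :: 'a::{field,finite} fls. p \<in> polys \<and> deg_le p (int n)}"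
proof (rule finite_imageD)
  let ?A = "{p :: 'a fls. p \<in> polys \<and> deg_le p (int n)}"
  let ?r = "\<lambda>p::'a fls. restrict (fls_nth p) {- int n..0}"
  show "finite (?r ` ?A)"
    by (rule finite_subset[of _ "PiE {- int n..0} (\<lambda>_. UNIV)"]) (auto intro!: finite_PiE)
  show "inj_on ?r ?A"
  proof (rule inj_onI, rule fls_eqI)
    fix p q i assume pq: "p \<in> ?A" "q \<in> ?A" "?r p = ?r q"
    consider "i < - int n" | "i > 0" | "i \<in> {- int n..0}" by fastforce
    then show "fls_nth p i = fls_nth q i"
    proof cases
      case 1 then show ?thesis using pq by (auto simp: deg_le_def)
    next
      case 2 then show ?thesis using pq by (auto simp: polys_nth)
    next
      case 3 then show ?thesis using pq(3) by (metis restrict_apply')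
    qed
  qed
qed

lemma polys_uminus: "p \<in> polys \<Longrightarrow> - p \<in> polys"
proof -
  have "- 1 \<in> (polys :: 'a fls set)"
    unfolding polys_def
    by (rule range_eqI[of _ _ "[:-1:]"]) (simp add: map_poly_pCons)
  then show "p \<in> polys \<Longrightarrow> - p \<in> polys" using polys_mult[of "-1" p] by simp
qed

lemma polys_diff: "p \<in> polys \<Longrightarrow> q \<in> polys \<Longrightarrow> p - q \<in> polys"
  using polys_add[of p "- q"] polys_uminus[of q] by simp

lemma polys_prod: "(\<And>i. i \<in> S \<Longrightarrow> f i \<in> polys) \<Longrightarrow> prod f S \<in> polys"
  by (induction S rule: infinite_finite_induct) (auto intro: polys_1 polys_mult)

lemma polys_X_inv_power: "fls_X_inv ^ n \<in> polys"
proof -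
  have "(fls_X_inv :: 'a fls) \<in> polys"
    unfolding polys_def by (rule range_eqI[of _ _ "[:0, 1:]"]) (simp add: map_poly_pCons)
  then show ?thesis by (induction n) (auto intro: polys_1 polys_mult)
qed

section \<open>The topology in terms of degrees\<close>

lemma dist_fls_le_iff:
  fixes a b :: "'a::field fls"
  shows "dist a b \<le> inverse (2 ^ n) \<longleftrightarrow> deg_le (a - b) (- int n)"
proof (cases "a = b")
  case False
  define s where "s = fls_subdegree (a - b)"
  show ?thesis
  proof (cases "s \<ge> 0")
    case True
    then obtain m where m: "s = int m" using nonneg_int_cases by blast
    have "dist a b = inverse (2 ^ m)"
      using False m by (simp add: dist_fls_def s_def)
    then show ?thesis using False m by (simp add: deg_le_iff deg_def flip: s_def)
  next
    case neg: False
    have "dist a b = 2 ^ nat (- s)" using False neg by (simp add: dist_fls_def s_def)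
    moreover have "(2::real) ^ nat (-s) > 1" using neg by simp
    moreover have "inverse (2 ^ n) \<le> (1::real)" by (simp add: inverse_le_1_iff)
    ultimately have "\<not> dist a b \<le> inverse (2 ^ n)" by linarith
    then show ?thesis using False neg by (auto simp: deg_le_iff deg_def simp flip: s_def)
  qed
qed simp


lemma open_fls_iff:
  fixes U :: "'a::field fls set"
  shows "open U \<longleftrightarrow> (\<forall>x\<in>U. \<exists>n::nat. \<forall>y. deg_le (y - x) (- int n) \<longrightarrow> y \<in> U)"
proof
  assume "open U"
  show "\<forall>x\<in>U. \<exists>n::nat. \<forall>y. deg_le (y - x) (- int n) \<longrightarrow> y \<in> U"
  proof
    fix x assume "x \<in> U"
    then obtain e where e: "e > 0" "\<And>y. dist y x < e \<Longrightarrow> y \<in> U"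
      using \<open>open U\<close> by (auto simp: open_dist)
    obtain n where "inverse (2::real) ^ n < e" using real_arch_pow_inv[of e "inverse 2"] e by auto
    then have "\<forall>y. deg_le (y - x) (- int n) \<longrightarrow> y \<in> U"
      using e(2) by (metis dist_fls_le_iff order_le_less_trans power_inverse)
    then show "\<exists>n::nat. \<forall>y. deg_le (y - x) (- int n) \<longrightarrow> y \<in> U" ..
  qed
next
  assume *: "\<forall>x\<in>U. \<exists>n::nat. \<forall>y. deg_le (y - x) (- int n) \<longrightarrow> y \<in> U"
  show "open U"
    unfolding open_dist
  proof
    fix x assume "x \<in> U"
    then obtain n where n: "\<And>y. deg_le (y - x) (- int n) \<Longrightarrow> y \<in> U" using * by blast
    show "\<exists>e>0. \<forall>y. dist y x < e \<longrightarrow> y \<in> U"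
      by (rule exI[of _ "inverse (2 ^ n)"]) (auto intro!: n simp flip: dist_fls_le_iff)
  qed
qed

lemma open_mat_iff:
  fixes U :: "('a::field fls ^ 'n ^ 'm) set"
  shows "open U \<longleftrightarrow>
    (\<forall>x\<in>U. \<exists>n::nat. \<forall>y. (\<forall>i j. deg_le (y $ i $ j - x $ i $ j) (- int n)) \<longrightarrow> y \<in> U)"
proof
  assume U: "open U"
  show "\<forall>x\<in>U. \<exists>n::nat. \<forall>y. (\<forall>i j. deg_le (y $ i $ j - x $ i $ j) (- int n)) \<longrightarrow> y \<in> U"
  proof
    fix x assume "x \<in> U"
    then obtain A where A: "\<And>i. open (A i)" "\<And>i. x $ i \<in> A i" "\<And>y. (\<forall>i. y $ i \<in> A i) \<Longrightarrow> y \<in> U"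
      using U unfolding open_vec_def by metis
    have "\<exists>B. (\<forall>j. open (B j) \<and> x $ i $ j \<in> B j) \<and> (\<forall>y. (\<forall>j. y $ j \<in> B j) \<longrightarrow> y \<in> A i)" for i
      using A(1,2)[of i] unfolding open_vec_def by auto
    then obtain B where B: "\<And>i j. open (B i j)" "\<And>i j. x $ i $ j \<in> B i j"
      "\<And>i y. (\<forall>j. y $ j \<in> B i j) \<Longrightarrow> y \<in> A i" by metis
    obtain n where n: "\<And>i j y. deg_le (y - x $ i $ j) (- int (n i j)) \<Longrightarrow> y \<in> B i j"
    proof -
      have "\<forall>i j. \<exists>n::nat. \<forall>y. deg_le (y - x $ i $ j) (- int n) \<longrightarrow> y \<in> B i j"
        using B(1,2) unfolding open_fls_iff by blast
      then show ?thesis using that by metis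
    qed
    \<comment> \<open>There are finitely many entries, so one radius serves for all.\<close>
    define N where "N = Max (range (\<lambda>(i, j). n i j))"
    have N: "n i j \<le> N" for i j
      unfolding N_def by (rule Max_ge) (auto intro: rev_image_eqI[of "(i, j)"])
    have "y \<in> U" if "\<forall>i j. deg_le (y $ i $ j - x $ i $ j) (- int N)" for y
      using that N by (intro A B allI n) (meson deg_le_mono neg_le_iff_le of_nat_mono)
    then show "\<exists>n::nat. \<forall>y. (\<forall>i j. deg_le (y $ i $ j - x $ i $ j) (- int n)) \<longrightarrow> y \<in> U" by blast
  qed
next
  assume *: "\<forall>x\<in>U. \<exists>n::nat. \<forall>y. (\<forall>i j. deg_le (y $ i $ j - x $ i $ j) (- int n)) \<longrightarrow> y \<in> U"
  have ball: "open {z. deg_le (z - c) (- int n)}" for c :: "'a fls" and n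
    unfolding open_fls_iff using deg_le_add by force
  show "open U"
  proof (subst open_vec_def, rule ballI)
    fix x assume "x \<in> U"
    then obtain n where n: "\<And>y. (\<forall>i j. deg_le (y $ i $ j - x $ i $ j) (- int n)) \<Longrightarrow> y \<in> U"
      using * by blast
    let ?A = "\<lambda>i. {v. \<forall>j. v $ j \<in> {z. deg_le (z - x $ i $ j) (- int n)}}"
    have "open (?A i)" for i
      using ball unfolding open_vec_def
      by (auto intro!: exI[of _ "\<lambda>j. {z. deg_le (z - x $ i $ j) (- int n)}"])
    then show "\<exists>A. (\<forall>i. open (A i) \<and> x $ i \<in> A i) \<and> (\<forall>y. (\<forall>i. y $ i \<in> A i) \<longrightarrow> y \<in> U)"
      using n by (intro exI[of _ ?A]) auto
  qed
qed

lemma open_mat_ball: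
  fixes h :: "'a::field fls ^ 'n ^ 'm"
  shows "open {g. \<forall>i j. deg_le (g $ i $ j - h $ i $ j) (- int n)}" (is "open ?V")
  unfolding open_mat_iff
proof (intro ballI exI allI impI)
  fix x y assume x: "x \<in> ?V" and y: "\<forall>i j. deg_le (y $ i $ j - x $ i $ j) (- int n)"
  have "deg_le ((y $ i $ j - x $ i $ j) + (x $ i $ j - h $ i $ j)) (- int n)" for i j
    using x y by (intro deg_le_add) auto
  then show "y \<in> ?V" by simp
qed

text \<open>The set is an additive group containing a ball about 0, hence open. Removing it from a
  compact set therefore leaves a compact set.\<close>

lemma open_deg_le: "open {z :: 'a::field fls. deg_le z n}"
proof -
  have "\<exists>m::nat. \<forall>y. deg_le (y - x) (- int m) \<longrightarrow> deg_le y n" if "deg_le x n" for x :: "'a fls"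
  proof (intro exI allI impI)
    fix y assume "deg_le (y - x) (- int (nat (- n)))"
    then have "deg_le (y - x) n" by (rule deg_le_mono) simp
    then have "deg_le (y - x + x) n" using that by (rule deg_le_add)
    then show "deg_le y n" by simp
  qed
  then show ?thesis unfolding open_fls_iff by blast
qed

text \<open>Tychonoff: the set is the image of a countable product of copies of the finite discrete
  field under the map from coefficient sequences to series.\<close>

lemma compact_deg_le: "compact {z :: 'a::{field,finite} fls. deg_le z n}"
proof -
  let ?X = "product_topology (\<lambda>_::nat. discrete_topology (UNIV :: 'a set)) UNIV"
  let ?\<phi> = "\<lambda>c::nat \<Rightarrow> 'a. fls_shift n (fps_to_fls (Abs_fps c))"
  have nth: "fls_nth (?\<phi> c) i = (if i + n \<ge> 0 then c (nat (i + n)) else 0)" for c i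
    by simp
  have "continuous_map ?X euclidean ?\<phi>"
    unfolding continuous_map_def
  proof (intro conjI allI impI)
    fix U :: "'a fls set" assume "openin euclidean U"
    then have U: "open U" by simp
    show "openin ?X {c \<in> topspace ?X. ?\<phi> c \<in> U}"
    proof (subst openin_subopen, intro ballI)
      fix c assume "c \<in> {c \<in> topspace ?X. ?\<phi> c \<in> U}"
      then obtain m where m: "\<And>y. deg_le (y - ?\<phi> c) (- int m) \<Longrightarrow> y \<in> U"
        using U unfolding open_fls_iff by blast
      \<comment> \<open>Series whose first \<open>m + n\<close> coefficients agree, counted from the
        power \<open>x^n\<close> downwards, differ by degree at most \<open>- m\<close>.\<close>
      define k where "k = nat (int m + n)"
      let ?T = "PiE UNIV (\<lambda>i. if i < k then {c i} else UNIV)"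
      have "openin ?X ?T"
        by (rule product_topology_basis)
           (auto intro: finite_subset[of _ "{..<k}"])
      moreover have "c \<in> ?T" by auto
      moreover have "?\<phi> d \<in> U" if "d \<in> ?T" for d
      proof (rule m)
        have "d i = c i" if "i < k" for i
          using \<open>d \<in> ?T\<close> that by (auto simp: PiE_iff split: if_splits)
        then show "deg_le (?\<phi> d - ?\<phi> c) (- int m)"
          unfolding deg_le_def by (auto simp: k_def)
      qed
      ultimately show "\<exists>T. openin ?X T \<and> c \<in> T \<and> T \<subseteq> {c \<in> topspace ?X. ?\<phi> c \<in> U}"
        by (intro exI[of _ ?T]) auto
    qed
  qed auto
  moreover have "compactin ?X (topspace ?X)"
    using compactin_PiE[of "\<lambda>_. discrete_topology (UNIV :: 'a set)" "UNIV :: nat set" "\<lambda>_. UNIV"]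
    by (simp add: compactin_discrete_topology)
  ultimately have "compactin euclidean (?\<phi> ` topspace ?X)"
    using image_compactin by blast
  moreover have "?\<phi> ` topspace ?X = {z. deg_le z n}"
  proof (intro equalityI subsetI)
    fix z assume "z \<in> {z :: 'a fls. deg_le z n}"
    then have z: "fls_nth z i = 0" if "i < - n" for i using that by (auto simp: deg_le_def)
    have "z = ?\<phi> (\<lambda>i. fls_nth z (int i - n))"
      by (rule fls_eqI) (auto simp: z)
    then show "z \<in> ?\<phi> ` topspace ?X" by auto
  qed (auto simp: deg_le_def)
  ultimately show ?thesis by simp
qed

section \<open>Orders with a split system of units\<close>

lemma polys_det:
  fixes g :: "'a::field fls ^ 'n ^ 'n"
  assumes "\<And>i j. g $ i $ j \<in> polys"
  shows "det g \<in> polys"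
proof -
  have "of_int (sign p) \<in> (polys :: 'a fls set)" for p :: "'n \<Rightarrow> 'n"
    by (cases "evenperm p") (auto simp: sign_def polys_1 polys_uminus)
  then show ?thesis
    unfolding det_def by (intro polys_sum polys_mult polys_prod assms)
qed

lemma matrix_vector_mult_eq_sum: "(A *v v) = (\<Sum>j\<in>UNIV. v $ j *s (\<chi> i. A $ i $ j))"
  for A :: "'a::comm_semiring_1 ^ 'n ^ 'm"
  by (simp add: vec_eq_iff matrix_vector_mult_def mult.commute)

lemma vec_prod_component: "(\<Prod>i\<in>S. g i) $ l = (\<Prod>i\<in>S. g i $ l)" for g :: "'i \<Rightarrow> 'a::comm_ring_1 ^ 'n"
  by (induction S rule: infinite_finite_induct) auto

lemma standard_lattice_add:
  "v \<in> standard_lattice \<Longrightarrow> w \<in> standard_lattice \<Longrightarrow> v + w \<in> standard_lattice"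
  by (auto simp: standard_lattice_def polys_add)

lemma standard_lattice_smult:
  "c \<in> polys \<Longrightarrow> v \<in> standard_lattice \<Longrightarrow> c *s v \<in> standard_lattice"
  by (auto simp: standard_lattice_def polys_mult)

lemma standard_lattice_axis: "axis j 1 \<in> standard_lattice"
  by (auto simp: standard_lattice_def axis_def polys_0 polys_1)

lemma card_less_enumeration:
  fixes f :: "'n::finite \<Rightarrow> nat"
  assumes "bij_betw f UNIV {..<CARD('n)}"
  shows "card {i. f i < f j} = f j"
proof -
  have "f ` {i. f i < f j} = {..<f j}"
  proof (intro equalityI subsetI)
    fix m assume "m \<in> {..<f j}"
    moreover have "f j < CARD('n)" using assms by (auto simp: bij_betw_def)
    ultimately have "m \<in> range f" using assms by (auto simp: bij_betw_def)
    then show "m \<in> f ` {i. f i < f j}" using \<open>m \<in> {..<f j}\<close> by auto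
  qed auto
  moreover have "inj_on f {i. f i < f j}"
    using assms by (auto simp: bij_betw_def intro: inj_on_subset)
  ultimately show ?thesis by (metis card_image card_lessThan)
qed

text \<open>The \<open>\<theta> l\<close> are the values of a root \<theta> of
  \<open>\<Prod>(Y - Q i) - 1\<close> under its evaluations. The matrix of degrees of the units
  \<open>\<theta> - Q i\<close> is symmetric with nearly constant off-diagonal entries, and
  \<open>k_large\<close> lets \<open>k\<close> outweigh the error terms in \<open>det_newton\<close>
  and \<open>normalize_diag\<close>.\<close>

locale split_order =
  fixes Q \<theta> :: "'n::finite \<Rightarrow> 'a::field fls" and k d :: int
  assumes d_eq [simp]: "int CARD('n) = d"
    and Q_polys: "Q i \<in> polys"
    and prod_eq_1: "(\<Prod>i\<in>UNIV. \<theta> l - Q i) = 1"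
    and deg_sym: "deg (\<theta> l - Q i) = deg (\<theta> i - Q l)"
    and deg_lower: "i \<noteq> l \<Longrightarrow> k \<le> deg (\<theta> l - Q i)"
    and deg_upper: "i \<noteq> l \<Longrightarrow> deg (\<theta> l - Q i) \<le> k + d"
    and k_large: "4 * d\<^sup>2 \<le> k"
begin

definition \<mu> :: "'n \<Rightarrow> 'n \<Rightarrow> int" where "\<mu> i l = deg (\<theta> l - Q i)"

text \<open>The image of \<open>\<theta> - Q i\<close> under the embedding of the order; products of
  vectors are componentwise.\<close>

definition unit :: "'n \<Rightarrow> 'a fls ^ 'n" where "unit i = (\<chi> l. \<theta> l - Q i)"

text \<open>The columns are the Newton polynomials at the nodes \<open>Q i\<close>, taken in the
  order of \<open>f\<close> and evaluated at the roots.\<close>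

definition newton :: "('n \<Rightarrow> nat) \<Rightarrow> 'a fls ^ 'n ^ 'n" where
  "newton f = (\<chi> l j. \<Prod>i | f i < f j. \<theta> l - Q i)"

text \<open>The embedded order \<open>F[x][\<theta>]\<close>; \<open>order_lattice_indep\<close>
  removes the dependence on \<open>f\<close>.\<close>

definition order_lattice :: "('n \<Rightarrow> nat) \<Rightarrow> ('a fls ^ 'n) set" where
  "order_lattice f = (\<lambda>v. newton f *v v) ` standard_lattice"

lemma d_pos: "d \<ge> 1"
  using zero_less_card_finite[where 'a='n] d_eq by linarith

lemma k_pos: "k \<ge> 4"
proof -
  have "1 * 1 \<le> d * d" using d_pos by (intro mult_mono) auto
  then show ?thesis using k_large by (simp add: power2_eq_square)
qed

lemma nonzero: "\<theta> l - Q i \<noteq> 0"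
proof
  assume "\<theta> l - Q i = 0"
  then have "(\<Prod>i\<in>UNIV. \<theta> l - Q i) = 0" by (intro prod_zero) auto
  then show False by (simp add: prod_eq_1)
qed

lemma sum_\<mu>: "(\<Sum>i\<in>UNIV. \<mu> i l) = 0"
  using deg_prod[of UNIV "\<lambda>i. \<theta> l - Q i"] nonzero by (simp add: \<mu>_def prod_eq_1)

lemma \<mu>_sym: "\<mu> i l = \<mu> l i"
  using deg_sym by (simp add: \<mu>_def)

lemma \<mu>_bounds: "i \<noteq> l \<Longrightarrow> k \<le> \<mu> i l" "i \<noteq> l \<Longrightarrow> \<mu> i l \<le> k + d"
  using deg_lower deg_upper by (auto simp: \<mu>_def)

lemma \<mu>_diag: "\<mu> i i = - (\<Sum>l\<in>-{i}. \<mu> i l)"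
proof -
  have "(\<Sum>l\<in>UNIV. \<mu> i l) = \<mu> i i + (\<Sum>l\<in>-{i}. \<mu> i l)"
    using sum.remove[of UNIV i "\<mu> i"] by (simp add: Compl_eq_Diff_UNIV)
  moreover have "(\<Sum>l\<in>UNIV. \<mu> i l) = (\<Sum>l\<in>UNIV. \<mu> l i)" by (rule sum.cong[OF refl \<mu>_sym])
  ultimately show ?thesis using sum_\<mu>[of i] by simp
qed

section \<open>Degrees in the Newton basis\<close>

lemma newton_nonzero: "newton f $ l $ j \<noteq> 0"
  using nonzero by (simp add: newton_def)

lemma deg_newton: "deg (newton f $ l $ j) = (\<Sum>i | f i < f j. \<mu> i l)"
  using nonzero by (simp add: newton_def deg_prod \<mu>_def)

lemma sum_\<mu>_bounds:
  assumes "l \<notin> S"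
  shows "k * int (card S) \<le> (\<Sum>i\<in>S. \<mu> i l)" "(\<Sum>i\<in>S. \<mu> i l) \<le> k * int (card S) + d\<^sup>2"
proof -
  have "int (card S) * k \<le> (\<Sum>i\<in>S. \<mu> i l)"
    using assms by (intro sum_bounded_below[of S k "\<lambda>i. \<mu> i l"] \<mu>_bounds) auto
  then show "k * int (card S) \<le> (\<Sum>i\<in>S. \<mu> i l)" by (simp add: mult.commute)
  have "(\<Sum>i\<in>S. \<mu> i l) \<le> int (card S) * (k + d)"
    using assms by (intro sum_bounded_above[of S "\<lambda>i. \<mu> i l"] \<mu>_bounds) auto
  moreover have "int (card S) * d \<le> d * d"
  proof (rule mult_right_mono)
    have "card S \<le> CARD('n)" by (simp add: card_mono)
    then show "int (card S) \<le> d" using d_eq by linarith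
  qed (use d_pos in simp)
  ultimately show "(\<Sum>i\<in>S. \<mu> i l) \<le> k * int (card S) + d\<^sup>2"
    by (simp add: algebra_simps power2_eq_square)
qed

context
  fixes f :: "'n \<Rightarrow> nat"
  assumes f: "bij_betw f UNIV {..<CARD('n)}"
begin

lemma enum_inj: "f i = f j \<longleftrightarrow> i = j"
  using f by (auto simp: bij_betw_def inj_def)

lemma enum_less: "f i < CARD('n)"
  using f by (auto simp: bij_betw_def)

lemma deg_newton_lower_ge: "f j \<le> f l \<Longrightarrow> k * int (f j) \<le> deg (newton f $ l $ j)"
  and deg_newton_lower_le: "f j \<le> f l \<Longrightarrow> deg (newton f $ l $ j) \<le> k * int (f j) + d\<^sup>2"
  using sum_\<mu>_bounds[of l "{i. f i < f j}"] card_less_enumeration[OF f]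
  by (auto simp: deg_newton)

text \<open>The product now contains the small factor with \<open>i = l\<close>. As the degrees of
  all factors sum to 0, it suffices to bound the complementary product, which avoids that
  factor.\<close>

lemma deg_newton_upper_le:
  assumes "f l < f j"
  shows "deg (newton f $ l $ j) \<le> k * int (f j) - k * d"
proof -
  have "(\<Sum>i | f i < f j. \<mu> i l) + (\<Sum>i | \<not> f i < f j. \<mu> i l) = (\<Sum>i\<in>UNIV. \<mu> i l)"
    by (subst sum.union_disjoint[symmetric]) (auto intro!: sum.cong)
  moreover have "k * int (card {i. \<not> f i < f j}) \<le> (\<Sum>i | \<not> f i < f j. \<mu> i l)"
    using assms by (intro sum_\<mu>_bounds) auto
  moreover have "card {i. \<not> f i < f j} = CARD('n) - f j"
    using card_Diff_subset[of "{i. f i < f j}" UNIV] card_less_enumeration[OF f]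
    by (simp add: Collect_neg_eq Compl_eq_Diff_UNIV)
  then have "int (card {i. \<not> f i < f j}) = d - int (f j)"
    using enum_less[of j] by simp
  ultimately show ?thesis
    by (simp add: deg_newton sum_\<mu> algebra_simps)
qed

text \<open>In the Leibniz formula the identity permutation gives the strictly dominant
  term.\<close>

lemma det_newton: "det (newton f) \<noteq> 0" "deg (det (newton f)) = (\<Sum>j\<in>UNIV. deg (newton f $ j $ j))"
proof -
  let ?W = "newton f" and ?s = "\<Sum>j\<in>UNIV. deg (newton f $ j $ j)"
  let ?t = "\<lambda>p. of_int (sign p) * (\<Prod>i\<in>UNIV. ?W $ i $ p i)"
  let ?P = "{p. p permutes (UNIV :: 'n set)}"
  have id: "?t id \<noteq> 0" "deg (?t id) = ?s"
    using newton_nonzero by (simp_all add: sign_id deg_prod)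
  have other: "deg_le (?t p) (?s - 1)" if p: "p permutes UNIV" "p \<noteq> id" for p
  proof -
    \<comment> \<open>Otherwise \<open>f (p l) \<le> f l\<close> everywhere; both sides have the
      same sum, so \<open>p\<close> would be the identity.\<close>
    have "\<exists>l. f l < f (p l)"
    proof (rule ccontr)
      assume no: "\<not> (\<exists>l. f l < f (p l))"
      have "(\<Sum>l\<in>UNIV. f (p l)) = (\<Sum>l\<in>UNIV. f l)"
        using sum.permute[OF p(1), of f] by (simp add: comp_def)
      then have "f (p l) = f l" for l
        using sum_mono_inv[of "\<lambda>l. f (p l)" UNIV f l] no by (force simp: not_less)
      then show False using enum_inj p(2) by auto
    qed
    then obtain l where l: "f l < f (p l)" ..
    \<comment> \<open>Compared with the diagonal, the entry in row \<open>l\<close> loses the degree \<open>k d\<close>, which exceeds the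
      total of the error terms \<open>d\<^sup>2\<close>.\<close>
    have entry: "deg (?W $ i $ p i) \<le> k * int (f (p i)) + d\<^sup>2 - (if i = l then k * d else 0)" for i
    proof -
      have "0 \<le> k * d" "0 \<le> d\<^sup>2" using k_pos d_pos by auto
      then show ?thesis
        using deg_newton_upper_le[of i "p i"] deg_newton_lower_le[of "p i" i] l
        by (cases "f i < f (p i)"; cases "i = l"; simp; linarith)
    qed
    have "(\<Sum>i\<in>UNIV. deg (?W $ i $ p i))
        \<le> (\<Sum>i\<in>UNIV. k * int (f (p i)) + d\<^sup>2 - (if i = l then k * d else 0))"
      by (intro sum_mono entry)
    also have "\<dots> = (\<Sum>i\<in>UNIV. k * int (f (p i))) + d * d\<^sup>2 - k * d"
      by (simp add: sum_subtractf sum.distrib)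
    also have "(\<Sum>i\<in>UNIV. k * int (f (p i))) = (\<Sum>i\<in>UNIV. k * int (f i))"
      using sum.permute[OF p(1), of "\<lambda>i. k * int (f i)"] by (simp add: comp_def)
    also have "d * d\<^sup>2 - k * d < 0"
    proof -
      have "d\<^sup>2 < k" using k_large d_pos by (smt (verit) zero_less_power)
      then have "d * d\<^sup>2 < d * k" using d_pos by (intro mult_strict_left_mono) auto
      then show ?thesis by (simp add: mult.commute)
    qed
    then have "(\<Sum>i\<in>UNIV. k * int (f i)) + d * d\<^sup>2 - k * d \<le> (\<Sum>i\<in>UNIV. k * int (f i)) - 1"
      by linarith
    also have "(\<Sum>i\<in>UNIV. k * int (f i)) \<le> ?s"
      by (intro sum_mono deg_newton_lower_ge) auto
    finally have "(\<Sum>i\<in>UNIV. deg (?W $ i $ p i)) \<le> ?s - 1" by simp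
    moreover have "deg (\<Prod>i\<in>UNIV. ?W $ i $ p i) = (\<Sum>i\<in>UNIV. deg (?W $ i $ p i))"
      by (rule deg_prod) (rule newton_nonzero)
    ultimately have "deg_le (\<Prod>i\<in>UNIV. ?W $ i $ p i) (?s - 1)"
      by (simp add: deg_le_iff)
    then show ?thesis by (cases "evenperm p") (auto simp: sign_def)
  qed
  have det: "det ?W = ?t id + (\<Sum>p\<in>?P - {id}. ?t p)"
    unfolding det_def by (rule sum.remove) (auto simp: permutes_id finite_permutations)
  have "deg_le (\<Sum>p\<in>?P - {id}. ?t p) (?s - 1)"
    by (intro deg_le_sum other) auto
  from deg_add_dominant[OF id(1) this] show "det ?W \<noteq> 0" "deg (det ?W) = ?s"
    unfolding det id(2) by auto
qed

section \<open>Stability of the order under its units\<close>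

lemma order_lattice_add:
  "x \<in> order_lattice f \<Longrightarrow> y \<in> order_lattice f \<Longrightarrow> x + y \<in> order_lattice f"
  unfolding order_lattice_def
  by (auto simp flip: matrix_vector_right_distrib intro: standard_lattice_add)

lemma order_lattice_smult:
  assumes "c \<in> polys" "x \<in> order_lattice f"
  shows "c *s x \<in> order_lattice f"
proof -
  obtain v where v: "v \<in> standard_lattice" "x = newton f *v v"
    using assms by (auto simp: order_lattice_def)
  then have "c *s x = newton f *v (c *s v)" by (simp add: vector_scalar_commute)
  then show ?thesis
    unfolding order_lattice_def using standard_lattice_smult[OF assms(1) v(1)] by blast
qed

lemma order_lattice_0: "0 \<in> order_lattice f"
  unfolding order_lattice_def by (rule image_eqI[of _ _ 0]) (auto simp: standard_lattice_def polys_0)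

lemma order_lattice_sum: "(\<And>i. i \<in> S \<Longrightarrow> g i \<in> order_lattice f) \<Longrightarrow> sum g S \<in> order_lattice f"
  by (induction S rule: infinite_finite_induct) (auto intro: order_lattice_0 order_lattice_add)

lemma order_lattice_column: "(\<chi> l. newton f $ l $ j) \<in> order_lattice f"
proof -
  have "newton f *v axis j 1 = (\<chi> l. newton f $ l $ j)"
    by (simp add: vec_eq_iff matrix_vector_mult_def axis_def if_distrib[of "\<lambda>x. _ * x"] cong: if_cong)
  then show ?thesis
    unfolding order_lattice_def using standard_lattice_axis by (metis imageI)
qed

lemma order_lattice_1: "1 \<in> order_lattice f"
proof -
  have "0 \<in> f ` UNIV" using f by (auto simp: bij_betw_def)
  then obtain j where "f j = 0" by auto
  then have "(\<chi> l. newton f $ l $ j) = 1" by (simp add: newton_def vec_eq_iff)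
  then show ?thesis using order_lattice_column[of j] by simp
qed

text \<open>The factor turns a Newton column into the next one; after the last,
  \<open>prod_eq_1\<close> leads back to the constant vector 1.\<close>

lemma order_lattice_unit_column: "unit j * (\<chi> l. newton f $ l $ j) \<in> order_lattice f"
proof (cases "Suc (f j) < CARD('n)")
  case True
  then have "Suc (f j) \<in> f ` UNIV" using f by (auto simp: bij_betw_def)
  then obtain j' where j': "f j' = Suc (f j)" by auto
  have "{i. f i < f j'} = insert j {i. f i < f j}"
    by (auto simp: j' less_Suc_eq enum_inj)
  then have "unit j * (\<chi> l. newton f $ l $ j) = (\<chi> l. newton f $ l $ j')"
    by (simp add: vec_eq_iff newton_def unit_def)
  then show ?thesis using order_lattice_column[of j'] by simp
next
  case False
  have all: "insert j {i. f i < f j} = UNIV"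
  proof -
    have "i = j \<or> f i < f j" for i
      using enum_less[of i] False enum_inj[of i j] by linarith
    then show ?thesis by auto
  qed
  have "(\<theta> l - Q j) * (\<Prod>i | f i < f j. \<theta> l - Q i) = (\<Prod>i\<in>insert j {i. f i < f j}. \<theta> l - Q i)" for l
    by simp
  then have "unit j * (\<chi> l. newton f $ l $ j) = 1"
    by (simp add: vec_eq_iff newton_def unit_def all prod_eq_1)
  then show ?thesis using order_lattice_1 by simp
qed

lemma order_lattice_unit:
  assumes "x \<in> order_lattice f"
  shows "unit i * x \<in> order_lattice f"
proof -
  obtain v where v: "v \<in> standard_lattice" "x = newton f *v v"
    using assms by (auto simp: order_lattice_def)
  \<comment> \<open>\<open>unit i\<close> and \<open>unit j\<close> differ by the polynomial
    \<open>Q j - Q i\<close>, so every column can be multiplied by its own unit.\<close>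
  have "unit i * x = (\<Sum>j\<in>UNIV. v $ j *s (unit j * (\<chi> l. newton f $ l $ j)
      + (Q j - Q i) *s (\<chi> l. newton f $ l $ j)))"
    unfolding v matrix_vector_mult_eq_sum sum_distrib_left
    by (rule sum.cong) (auto simp: vec_eq_iff unit_def algebra_simps)
  also have "\<dots> \<in> order_lattice f"
    using v(1) by (intro order_lattice_sum order_lattice_smult order_lattice_add
        order_lattice_unit_column order_lattice_column polys_diff Q_polys)
      (auto simp: standard_lattice_def)
  finally show ?thesis .
qed

lemma order_lattice_prod_unit:
  "x \<in> order_lattice f \<Longrightarrow> (\<Prod>i\<in>S. unit i) * x \<in> order_lattice f"
  by (induction S rule: infinite_finite_induct) (auto simp: mult.assoc intro: order_lattice_unit)

end

text \<open>Every Newton column is a product of units applied to 1, hence lies in the lattice for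
  any other enumeration. The enumeration can therefore be adapted to a diagonal matrix
  later.\<close>

lemma order_lattice_indep:
  assumes f: "bij_betw f UNIV {..<CARD('n)}" and g: "bij_betw g UNIV {..<CARD('n)}"
  shows "order_lattice f = order_lattice g"
proof -
  have "order_lattice g \<subseteq> order_lattice f"
    if f: "bij_betw f UNIV {..<CARD('n)}" and g: "bij_betw g UNIV {..<CARD('n)}" for f g
  proof
    fix x assume "x \<in> order_lattice g"
    then obtain v where v: "v \<in> standard_lattice" "x = newton g *v v"
      by (auto simp: order_lattice_def)
    have "(\<chi> l. newton g $ l $ j) = (\<Prod>i | g i < g j. unit i) * 1" for j
      by (simp add: vec_eq_iff vec_prod_component newton_def unit_def)
    then have "(\<chi> l. newton g $ l $ j) \<in> order_lattice f" for j
      using order_lattice_prod_unit[OF f order_lattice_1[OF f]] by metis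
    then show "x \<in> order_lattice f"
      unfolding v(2) matrix_vector_mult_eq_sum using v(1)
      by (intro order_lattice_sum order_lattice_smult f) (auto simp: standard_lattice_def)
  qed
  then show ?thesis using f g by blast
qed

section \<open>Reduction of diagonal matrices by units\<close>

lemma unit_image_order_lattice:
  assumes f: "bij_betw f UNIV {..<CARD('n)}"
  shows "(*) (unit i) ` order_lattice f = order_lattice f"
proof (intro equalityI subsetI)
  fix x assume x: "x \<in> order_lattice f"
  \<comment> \<open>The inverse of a unit is the product of all the others.\<close>
  have "unit i * ((\<Prod>i\<in>-{i}. unit i) * x) = (\<Prod>i\<in>UNIV. unit i) * x"
    using prod.remove[of UNIV i unit] by (simp add: Compl_eq_Diff_UNIV mult.assoc)
  also have "(\<Prod>i\<in>UNIV. unit i) = 1"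
    by (simp add: vec_eq_iff vec_prod_component unit_def prod_eq_1)
  finally have "x = unit i * ((\<Prod>i\<in>-{i}. unit i) * x)" by simp
  then show "x \<in> (*) (unit i) ` order_lattice f"
    using order_lattice_prod_unit[OF f x] by blast
qed (auto intro: order_lattice_unit[OF f])

text \<open>At a minimiser of the sum of squared degrees, multiplication by \<open>unit i\<close> or
  its inverse cannot decrease the sum. This bounds the pairing of the degree vector with each row of
  \<open>\<mu>\<close>; the rows belonging to the largest and the smallest degree then bound the
  spread.\<close>

lemma normalize_diag:
  assumes f: "bij_betw f UNIV {..<CARD('n)}" and a: "\<And>i. a $ i \<noteq> 0"
  obtains b where "\<And>i. b $ i \<noteq> 0" "(*) b ` order_lattice f = (*) a ` order_lattice f"
    "\<And>i l. deg (b $ i) - deg (b $ l) \<le> k * d"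
proof -
  let ?L = "order_lattice f"
  define P where "P = (\<lambda>b. (\<forall>i. b $ i \<noteq> 0) \<and> (*) b ` ?L = (*) a ` ?L)"
  define N where "N = (\<lambda>b::'a fls ^ 'n. nat (\<Sum>j\<in>UNIV. (deg (b $ j))\<^sup>2))"
  have "P a" using a by (simp add: P_def)
  then obtain b where b: "P b" "\<And>c. P c \<Longrightarrow> N b \<le> N c"
    using ex_has_least_nat[of P a N] by blast
  define \<tau> where "\<tau> = (\<lambda>j. deg (b $ j))"
  have min: "(\<Sum>j\<in>UNIV. (\<tau> j)\<^sup>2) \<le> (\<Sum>j\<in>UNIV. (deg (c $ j))\<^sup>2)" if "P c" for c
    using b(2)[OF that] sum_nonneg[of UNIV "\<lambda>j. (deg (c $ j))\<^sup>2"] unfolding N_def \<tau>_def by simp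
  have b0: "b $ i \<noteq> 0" for i using b(1) by (simp add: P_def)
  let ?u' = "\<lambda>i. \<chi> j. inverse (unit i $ j)"
  have unit0: "unit i $ j \<noteq> 0" for i j using nonzero by (simp add: unit_def)
  have uu': "?u' i * (unit i * x) = x" for i x
    using unit0 by (simp add: vec_eq_iff mult.assoc[symmetric])
  have P1: "P (unit i * b)" for i
  proof -
    have "(*) (unit i * b) ` ?L = (*) b ` ((*) (unit i) ` ?L)"
      by (simp add: image_image mult_ac)
    then show ?thesis
      using b(1) unit0 unit_image_order_lattice[OF f] by (simp add: P_def)
  qed
  have P2: "P (?u' i * b)" for i
  proof -
    have "(*) (?u' i * b) ` ?L = (*) b ` ((*) (?u' i) ` ((*) (unit i) ` ?L))"
      using unit_image_order_lattice[OF f] by (simp add: image_image mult_ac)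
    also have "(*) (?u' i) ` ((*) (unit i) ` ?L) = ?L"
      by (simp add: image_image uu')
    finally show ?thesis
      using b(1) unit0 by (simp add: P_def)
  qed
  have sum0: "(\<Sum>j\<in>UNIV. \<mu> i j) = 0" for i
  proof -
    have "(\<Sum>j\<in>UNIV. \<mu> i j) = (\<Sum>j\<in>UNIV. \<mu> j i)" by (rule sum.cong[OF refl \<mu>_sym])
    then show ?thesis by (simp add: sum_\<mu>)
  qed
  \<comment> \<open>The diagonal entry is at most \<open>(d - 1) * (k + d)\<close> in absolute
    value, the other \<open>d - 1\<close> entries at most \<open>k + d\<close>, and
    \<open>(d - 1)^2 + (d - 1) = d * (d - 1)\<close>.\<close>
  have sq: "(\<Sum>j\<in>UNIV. (\<mu> i j)\<^sup>2) \<le> d * (d - 1) * (k + d)\<^sup>2" for i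
  proof -
    have card: "int (card (- {i})) = d - 1"
      using d_pos by (simp add: Compl_eq_Diff_UNIV card_Diff_singleton of_nat_diff)
    have "(\<Sum>l\<in>-{i}. \<mu> i l) \<le> (d - 1) * (k + d)"
      using sum_bounded_above[of "-{i}" "\<mu> i" "k + d"] \<mu>_bounds(2)[of i] card by auto
    moreover have "0 \<le> (\<Sum>l\<in>-{i}. \<mu> i l)"
      using \<mu>_bounds(1)[of i] k_pos by (intro sum_nonneg) force
    ultimately have "(\<mu> i i)\<^sup>2 \<le> ((d - 1) * (k + d))\<^sup>2"
      unfolding \<mu>_diag by (simp add: power_mono)
    moreover have "(\<Sum>j\<in>-{i}. (\<mu> i j)\<^sup>2) \<le> (d - 1) * (k + d)\<^sup>2"
    proof -
      have "(\<mu> i j)\<^sup>2 \<le> (k + d)\<^sup>2" if "j \<in> -{i}" for j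
        using that \<mu>_bounds[of i j] k_pos by (intro power_mono) auto
      then show ?thesis
        using sum_bounded_above[of "-{i}" "\<lambda>j. (\<mu> i j)\<^sup>2" "(k + d)\<^sup>2"] card by auto
    qed
    moreover have "(\<Sum>j\<in>UNIV. (\<mu> i j)\<^sup>2) = (\<mu> i i)\<^sup>2 + (\<Sum>j\<in>-{i}. (\<mu> i j)\<^sup>2)"
      using sum.remove[of UNIV i "\<lambda>j. (\<mu> i j)\<^sup>2"] by (simp add: Compl_eq_Diff_UNIV)
    moreover have "((d - 1) * (k + d))\<^sup>2 + (d - 1) * (k + d)\<^sup>2 = d * (d - 1) * (k + d)\<^sup>2"
      by (simp add: power2_eq_square algebra_simps)
    ultimately show ?thesis by linarith
  qed
  \<comment> \<open>Row sums of \<open>\<mu>\<close> vanish, so the degrees may be centred at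
    \<open>\<tau> i\<close>; the diagonal entry \<open>\<mu> i i\<close> then drops out.\<close>
  have shift: "(\<Sum>j\<in>UNIV. \<tau> j * \<mu> i j) = (\<Sum>j\<in>UNIV. (\<tau> j - \<tau> i) * \<mu> i j)" for i
    by (simp add: left_diff_distrib sum_subtractf sum0 flip: sum_distrib_left)
  have expand: "(\<Sum>j\<in>UNIV. (\<tau> j + c * \<mu> i j)\<^sup>2)
      = (\<Sum>j\<in>UNIV. (\<tau> j)\<^sup>2) + 2 * c * (\<Sum>j\<in>UNIV. \<tau> j * \<mu> i j) + c\<^sup>2 * (\<Sum>j\<in>UNIV. (\<mu> i j)\<^sup>2)" for i c
    by (simp add: power2_sum sum.distrib sum_distrib_left power_mult_distrib algebra_simps)
  have up: "- (2 * (\<Sum>j\<in>UNIV. (\<tau> j - \<tau> i) * \<mu> i j)) \<le> d * (d - 1) * (k + d)\<^sup>2" for i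
  proof -
    have "deg ((unit i * b) $ j) = \<tau> j + 1 * \<mu> i j" for j
      using nonzero b0 by (simp add: unit_def \<tau>_def \<mu>_def deg_mult)
    then show ?thesis
      using min[OF P1[of i]] sq[of i] expand[of 1 i] by (simp add: shift)
  qed
  have down: "2 * (\<Sum>j\<in>UNIV. (\<tau> j - \<tau> i) * \<mu> i j) \<le> d * (d - 1) * (k + d)\<^sup>2" for i
  proof -
    have "deg ((?u' i * b) $ j) = \<tau> j + (-1) * \<mu> i j" for j
      using nonzero b0 by (simp add: unit_def \<tau>_def \<mu>_def deg_mult deg_inverse)
    then show ?thesis
      using min[OF P2[of i]] sq[of i] expand[of "-1" i] by (simp add: shift)
  qed
  have fin: "finite (range \<tau>)" "range \<tau> \<noteq> {}" by auto
  obtain p where p: "\<tau> p = Max (range \<tau>)" using Max_in[OF fin] by (metis imageE)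
  obtain q where q: "\<tau> q = Min (range \<tau>)" using Min_in[OF fin] by (metis imageE)
  have pj: "\<tau> j \<le> \<tau> p" and qj: "\<tau> q \<le> \<tau> j" for j
    using p q fin by auto
  \<comment> \<open>Centred at an extreme value, all terms have one sign, and each off-diagonal
    entry of \<open>\<mu>\<close> can be replaced by its lower bound \<open>k\<close>.\<close>
  have "(\<Sum>j\<in>UNIV. k * (\<tau> p - \<tau> j)) \<le> (\<Sum>j\<in>UNIV. - ((\<tau> j - \<tau> p) * \<mu> p j))"
  proof (rule sum_mono)
    fix j show "k * (\<tau> p - \<tau> j) \<le> - ((\<tau> j - \<tau> p) * \<mu> p j)"
      using mult_right_mono[of k "\<mu> p j" "\<tau> p - \<tau> j"] \<mu>_bounds(1)[of p j] pj[of j]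
      by (cases "p = j") (auto simp: algebra_simps)
  qed
  moreover have "(\<Sum>j\<in>UNIV. k * (\<tau> j - \<tau> q)) \<le> (\<Sum>j\<in>UNIV. (\<tau> j - \<tau> q) * \<mu> q j)"
  proof (rule sum_mono)
    fix j show "k * (\<tau> j - \<tau> q) \<le> (\<tau> j - \<tau> q) * \<mu> q j"
      using mult_right_mono[of k "\<mu> q j" "\<tau> j - \<tau> q"] \<mu>_bounds(1)[of q j] qj[of j]
      by (cases "q = j") (auto simp: algebra_simps)
  qed
  moreover have "(\<Sum>j\<in>UNIV. k * (\<tau> p - \<tau> j)) + (\<Sum>j\<in>UNIV. k * (\<tau> j - \<tau> q)) = d * (k * (\<tau> p - \<tau> q))"
    by (simp add: sum.distrib[symmetric] algebra_simps)
  ultimately have "d * (k * (\<tau> p - \<tau> q)) \<le> d * ((d - 1) * (k + d)\<^sup>2)"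
    using up[of p] down[of q] by (simp add: sum_negf)
  then have "k * (\<tau> p - \<tau> q) \<le> (d - 1) * (k + d)\<^sup>2"
    using d_pos by simp
  \<comment> \<open>The coefficient \<open>d - 1\<close> leaves a spare \<open>k * k\<close>, which
    by \<open>k_large\<close> outweighs the terms \<open>2 * k * d^2 + d^3\<close>.\<close>
  also have "\<dots> \<le> d * (k * k)"
  proof -
    have "k * (4 * d\<^sup>2) \<le> k * k" using k_large k_pos by (intro mult_left_mono) auto
    moreover have "d * d\<^sup>2 \<le> k * d\<^sup>2"
    proof (intro mult_right_mono)
      have "d * 1 \<le> d * d" using d_pos by (intro mult_left_mono) auto
      then show "d \<le> k" using k_large d_pos unfolding power2_eq_square by linarith
    qed auto
    moreover have "(d - 1) * (k + d)\<^sup>2 = d * (k * k) - k * k + 2 * (k * d\<^sup>2) - 2 * (k * d) + d * d\<^sup>2 - d\<^sup>2"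
      by (simp add: power2_eq_square algebra_simps)
    moreover have "0 \<le> k * d" "0 \<le> d\<^sup>2" "0 \<le> k * d\<^sup>2" using k_pos d_pos by auto
    ultimately show ?thesis by linarith
  qed
  finally have "k * (\<tau> p - \<tau> q) \<le> k * (k * d)" by (simp add: mult_ac)
  then have "\<tau> p - \<tau> q \<le> k * d" using k_pos by simp
  then have range: "deg (b $ i) - deg (b $ l) \<le> k * d" for i l
    using pj[of i] qj[of l] by (simp add: \<tau>_def)
  show ?thesis
    using b(1) unfolding P_def by (intro that[of b] b0 range) simp
qed

end

section \<open>Roots of split polynomials\<close>

lemma dist_fls_powi:
  fixes a b :: "'a::field fls"
  assumes "a \<noteq> b"
  shows "dist a b = 2 powi deg (a - b)"
  using assms by (auto simp: dist_fls_def deg_def power_int_def inverse_eq_divide power_divide)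

text \<open>Each factor has degree at most -1, and a difference of inverses is the difference of the
  arguments times two such factors. Peeling off one factor at a time, every term of the telescoped
  difference loses at least one degree.\<close>

lemma prod_inverse_contraction:
  fixes z z' :: "'a::field fls"
  assumes "deg_le z 0" "deg_le z' 0" "deg_le (z - z') m" "\<And>i. i \<in> I \<Longrightarrow> deg (a i) \<ge> 1"
  shows "deg_le (\<Prod>i\<in>I. inverse (z + a i)) 0 \<and>
    deg_le ((\<Prod>i\<in>I. inverse (z + a i)) - (\<Prod>i\<in>I. inverse (z' + a i))) (m - 1)"
  using assms(4)
proof (induction I rule: infinite_finite_induct)
  case (insert j I)
  have a: "a j \<noteq> 0" "deg (a j) \<ge> 1" using insert.prems[of j] by (auto simp: deg_def)
  have *: "w + a j \<noteq> 0 \<and> deg_le (inverse (w + a j)) (-1)" if "deg_le w 0" for w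
    using deg_add_dominant[of "a j" w 0] that a by (simp add: add.commute deg_le_iff deg_inverse)
  let ?p = "\<lambda>z. \<Prod>i\<in>I. inverse (z + a i)"
  have "inverse (z + a j) * ?p z - inverse (z' + a j) * ?p z'
    = (z' - z) * (inverse (z + a j) * inverse (z' + a j) * ?p z) + inverse (z' + a j) * (?p z - ?p z')"
  proof -
    have "inverse (z + a j) - inverse (z' + a j) = (z' - z) * (inverse (z + a j) * inverse (z' + a j))"
      using *[OF assms(1)] *[OF assms(2)] by (simp add: field_simps)
    then have "inverse (z + a j) * ?p z - inverse (z' + a j) * ?p z
      = (z' - z) * (inverse (z + a j) * inverse (z' + a j)) * ?p z"
      by (simp only: left_diff_distrib[symmetric])
    then show ?thesis by (simp add: algebra_simps)
  qed
  moreover have "deg_le ((z' - z) * (inverse (z + a j) * inverse (z' + a j) * ?p z)) (m + (-1 + -1 + 0))"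
    using assms(3) deg_le_uminus[of "z - z'" m] * assms(1,2) insert
    by (intro deg_le_mult) (auto simp del: deg_le_uminus)
  moreover have "deg_le (inverse (z' + a j) * (?p z - ?p z')) (-1 + (m - 1))"
    using * assms(1,2) insert by (intro deg_le_mult) auto
  ultimately have "deg_le (inverse (z + a j) * ?p z - inverse (z' + a j) * ?p z') (m - 1)"
    by (auto intro!: deg_le_add elim: deg_le_mono)
  moreover have "deg_le (inverse (z + a j) * ?p z) (-1 + 0)"
    using * assms(1) insert by (intro deg_le_mult) auto
  ultimately show ?case
    using insert.hyps by (auto elim: deg_le_mono)
qed (auto simp: deg_le_iff)

text \<open>The equation says that \<open>z\<close> is a fixed point of the product of the inverses
  of \<open>z + a i\<close>. By the contraction estimate Banach's theorem applies; losing one degree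
  halves the distance, whence the constant 1/2.\<close>

lemma ex_small_root:
  fixes a :: "'i \<Rightarrow> 'a::{field,finite} fls"
  assumes "\<And>i. i \<in> I \<Longrightarrow> deg (a i) \<ge> 1"
  obtains z where "deg_le z 0" "z * (\<Prod>i\<in>I. z + a i) = 1"
proof -
  let ?S = "{z::'a fls. deg_le z 0}"
  let ?F = "\<lambda>z. \<Prod>i\<in>I. inverse (z + a i)"
  have "\<exists>!z\<in>?S. ?F z = z"
  proof (rule Banach_fix[where c = "1/2"])
    show "complete ?S" by (rule compact_imp_complete[OF compact_deg_le])
    show "?F ` ?S \<subseteq> ?S"
      using prod_inverse_contraction[OF _ _ deg_le_deg assms, of _ _ I] by auto
  next
    fix x y assume xy: "x \<in> ?S" "y \<in> ?S"
    have "deg_le (?F x - ?F y) (deg (x - y) - 1)"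
      using prod_inverse_contraction[OF _ _ deg_le_deg assms, of x y I] xy by auto
    then have "dist (?F x) (?F y) \<le> 1/2 * dist x y" if "?F x \<noteq> ?F y"
    proof -
      have "x \<noteq> y" using that by auto
      have "dist (?F x) (?F y) = 2 powi deg (?F x - ?F y)"
        using that by (rule dist_fls_powi)
      also have "\<dots> \<le> 2 powi (deg (x - y) - 1)"
        using \<open>deg_le _ _\<close> that by (intro power_int_increasing) (auto simp: deg_le_iff)
      also have "\<dots> = 1/2 * 2 powi deg (x - y)" by (simp add: power_int_diff)
      finally show ?thesis using \<open>x \<noteq> y\<close> by (simp add: dist_fls_powi)
    qed
    then show "dist (?F x) (?F y) \<le> 1/2 * dist x y"
      by (cases "?F x = ?F y") auto
  qed (auto intro: exI[of _ 0])
  then obtain z where z: "deg_le z 0" "?F z = z" by auto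
  have "z + a i \<noteq> 0" if "i \<in> I" for i
  proof -
    have "a i \<noteq> 0" using assms[OF that] by (auto simp: deg_def)
    then show ?thesis
      using deg_add_dominant(1)[of "a i" z 0] assms[OF that] z(1) by (simp add: add.commute)
  qed
  then have "?F z * (\<Prod>i\<in>I. z + a i) = 1"
    by (simp flip: prod.distrib)
  then show ?thesis using that z by simp
qed

section \<open>Construction of split orders\<close>

lemma deg_X_inv_power: "deg (fls_X_inv ^ n :: 'a::field fls) = int n"
  by (simp add: deg_def)

lemma deg_X_inv_power_diff:
  assumes "m \<noteq> n"
  shows "deg (fls_X_inv ^ m - fls_X_inv ^ n :: 'a::field fls) = int (max m n)"
proof -
  have *: "deg (fls_X_inv ^ m - fls_X_inv ^ n :: 'a fls) = int m" if "n < m" for m n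
    using deg_add_dominant(2)[of "fls_X_inv ^ m :: 'a fls" "- (fls_X_inv ^ n)" "int n"] that
    by (simp add: deg_X_inv_power deg_le_iff)
  show ?thesis
  proof (cases "n < m")
    case False
    then have "deg (- (fls_X_inv ^ n - fls_X_inv ^ m) :: 'a fls) = int n"
      using assms by (subst deg_uminus) (auto intro!: *)
    then show ?thesis using False by simp
  qed (simp add: *)
qed

text \<open>For \<open>Q i = x^(K + f i)\<close> the difference of two nodes has degree
  \<open>K\<close> plus the larger index, which is symmetric and in the required range. The root
  near \<open>Q l\<close> is \<open>Q l\<close> plus a correction of degree at most 0, too small to
  change these degrees.\<close>

lemma ex_split_order:
  assumes f: "bij_betw f (UNIV :: 'n::finite set) {..<CARD('n)}"
    and K: "4 * CARD('n)\<^sup>2 \<le> K"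
  shows "\<exists>Q \<theta> :: 'n \<Rightarrow> 'a::{field,finite} fls. split_order Q \<theta> (int K) (int CARD('n))"
proof -
  have inj: "f i = f j \<longleftrightarrow> i = j" for i j using f by (auto simp: bij_betw_def inj_def)
  have less: "f i < CARD('n)" for i using f by (auto simp: bij_betw_def)
  have K1: "K \<ge> 1" using K by (metis One_nat_def Suc_leI le_trans mult_pos_pos zero_less_card_finite zero_less_numeral zero_less_power)
  define Q :: "'n \<Rightarrow> 'a fls" where "Q i = fls_X_inv ^ (K + f i)" for i
  have degQ: "deg (Q l - Q i) = int (K + max (f l) (f i))" if "i \<noteq> l" for i l
    using that inj unfolding Q_def by (subst deg_X_inv_power_diff) auto
  have "\<exists>z. deg_le z 0 \<and> z * (\<Prod>i\<in>-{l}. z + (Q l - Q i)) = 1" for l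
    by (rule ex_small_root[of "-{l}" "\<lambda>i. Q l - Q i"]) (use degQ K1 in auto)
  then obtain z where z: "\<And>l. deg_le (z l) 0" "\<And>l. z l * (\<Prod>i\<in>-{l}. z l + (Q l - Q i)) = 1"
    by metis
  define \<theta> where "\<theta> l = Q l + z l" for l
  have deg: "deg (\<theta> l - Q i) = int (K + max (f l) (f i))" if "i \<noteq> l" for i l
  proof -
    have "\<theta> l - Q i = (Q l - Q i) + z l" by (simp add: \<theta>_def)
    moreover have "Q l - Q i \<noteq> 0" using degQ[OF that] K1 by (auto simp: deg_def)
    moreover have "0 < deg (Q l - Q i)" using degQ[OF that] K1 by simp
    ultimately show ?thesis
      using deg_add_dominant(2)[of "Q l - Q i" "z l" 0] z(1)[of l] degQ[OF that] by metis
  qed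
  have "split_order Q \<theta> (int K) (int CARD('n))"
  proof
    show "(\<Prod>i\<in>UNIV. \<theta> l - Q i) = 1" for l
      using z(2)[of l] prod.remove[of UNIV l "\<lambda>i. \<theta> l - Q i"]
      by (simp add: Compl_eq_Diff_UNIV \<theta>_def algebra_simps)
    show "deg (\<theta> l - Q i) = deg (\<theta> i - Q l)" for i l
      by (cases "i = l") (auto simp: deg max.commute)
    show "int K \<le> deg (\<theta> l - Q i)" if "i \<noteq> l" for i l using that by (simp add: deg)
    show "deg (\<theta> l - Q i) \<le> int K + int CARD('n)" if "i \<noteq> l" for i l
      using that less[of i] less[of l] by (simp add: deg)
    show "4 * (int CARD('n))\<^sup>2 \<le> int K" using K by (metis of_nat_le_iff of_nat_mult of_nat_numeral of_nat_power)
  qed (auto simp: Q_def polys_X_inv_power)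
  then show ?thesis by blast
qed

section \<open>Lattices close to a fixed one\<close>

lemma ex_sorting_enumeration:
  fixes \<tau> :: "'n::finite \<Rightarrow> int"
  obtains g where "bij_betw g UNIV {..<CARD('n)}" "\<And>i j. g i < g j \<Longrightarrow> \<tau> j \<le> \<tau> i"
proof -
  obtain xs :: "'n list" where xs: "set xs = UNIV" "distinct xs"
    using finite_distinct_list[of "UNIV :: 'n set"] by auto
  define ys where "ys = sort_key (\<lambda>i. - \<tau> i) xs"
  have len: "length ys = CARD('n)" using xs distinct_card[of xs] by (simp add: ys_def)
  have bij: "bij_betw ((!) ys) {..<CARD('n)} UNIV"
    using bij_betw_nth[of ys "{..<CARD('n)}" UNIV] xs len by (simp add: ys_def)
  define g where "g = inv_into {..<CARD('n)} ((!) ys)"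
  have g: "bij_betw g UNIV {..<CARD('n)}"
    unfolding g_def by (rule bij_betw_inv_into[OF bij])
  have nth: "ys ! g i = i" for i
    unfolding g_def using bij_betw_inv_into_right[OF bij] by simp
  have "\<tau> j \<le> \<tau> i" if "g i < g j" for i j
  proof -
    have "sorted (map (\<lambda>i. - \<tau> i) ys)" by (simp add: ys_def)
    moreover have "g j < length ys" using g len by (auto simp: bij_betw_def)
    ultimately have "map (\<lambda>i. - \<tau> i) ys ! g i \<le> map (\<lambda>i. - \<tau> i) ys ! g j"
      using that by (intro sorted_nth_mono) auto
    then show ?thesis using that \<open>g j < length ys\<close> by (simp add: nth)
  qed
  then show ?thesis using g that by blast
qed

lemma standard_lattice_image_subset:
  fixes A P :: "'a::field fls ^ 'n ^ 'n"
  assumes "(\<lambda>v. A *v v) ` standard_lattice \<subseteq> (\<lambda>v. P *v v) ` standard_lattice"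
  obtains \<gamma> where "\<And>i j. \<gamma> $ i $ j \<in> polys" "P ** \<gamma> = A"
proof -
  have "\<exists>w. w \<in> standard_lattice \<and> P *v w = A *v axis j 1" for j
    using assms standard_lattice_axis[of j] by (force simp: image_subset_iff)
  then obtain w where w: "\<And>j. w j \<in> standard_lattice" "\<And>j. P *v w j = A *v axis j 1"
    by metis
  define \<gamma> where "\<gamma> = (\<chi> i j. w j $ i)"
  have "(P ** \<gamma>) $ i $ j = A $ i $ j" for i j
  proof -
    have "(P ** \<gamma>) $ i $ j = (P *v w j) $ i"
      by (simp add: matrix_matrix_mult_def matrix_vector_mult_def \<gamma>_def)
    also have "\<dots> = A $ i $ j"
      unfolding w(2)
      by (simp add: matrix_vector_mult_def axis_def if_distrib[of "\<lambda>x. _ * x"] cong: if_cong)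
    finally show ?thesis .
  qed
  then have "P ** \<gamma> = A" by (simp add: vec_eq_iff)
  moreover have "\<gamma> $ i $ j \<in> polys" for i j
    using w(1) by (simp add: \<gamma>_def standard_lattice_def)
  ultimately show ?thesis using that by blast
qed

lemma standard_lattice_image_eq:
  fixes A P :: "'a::field fls ^ 'n ^ 'n"
  assumes "invertible A" "(\<lambda>v. A *v v) ` standard_lattice = (\<lambda>v. P *v v) ` standard_lattice"
  obtains \<gamma> \<gamma>' where "\<gamma> \<in> GL_polys" "\<And>i j. \<gamma> $ i $ j \<in> polys" "\<And>i j. \<gamma>' $ i $ j \<in> polys"
    "P ** \<gamma> = A" "A ** \<gamma>' = P" "\<gamma>' ** \<gamma> = mat 1"
proof -
  obtain \<gamma> where \<gamma>: "\<And>i j. \<gamma> $ i $ j \<in> polys" "P ** \<gamma> = A"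
    using standard_lattice_image_subset[of A P] assms(2) by auto
  obtain \<gamma>' where \<gamma>': "\<And>i j. \<gamma>' $ i $ j \<in> polys" "A ** \<gamma>' = P"
    using standard_lattice_image_subset[of P A] assms(2) by auto
  obtain A' where A': "A' ** A = mat 1"
    using assms(1) by (auto simp: invertible_def)
  have "\<gamma>' ** \<gamma> = A' ** (A ** \<gamma>' ** \<gamma>)" by (simp add: matrix_mul_assoc A')
  also have "\<dots> = mat 1" by (simp add: \<gamma> \<gamma>' A')
  finally have inv: "\<gamma>' ** \<gamma> = mat 1" .
  then have "\<gamma> ** \<gamma>' = mat 1" by (simp add: matrix_left_right_inverse)
  then have "\<gamma> \<in> GL_polys"
    unfolding GL_polys_def using \<gamma>(1) \<gamma>'(1) inv by blast
  then show ?thesis using that \<gamma> \<gamma>' inv by blast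
qed

section \<open>Diagonal matrices and size estimates\<close>

definition diag_matrix :: "'a::zero ^ 'n \<Rightarrow> 'a ^ 'n ^ 'n" where
  "diag_matrix a = (\<chi> i j. if i = j then a $ i else 0)"

lemma diag_matrix_mult_component: "(diag_matrix a ** g) $ i $ j = a $ i * g $ i $ j"
  for g :: "'a::field ^ 'n ^ 'm"
  by (simp add: diag_matrix_def matrix_matrix_mult_def if_distrib[of "\<lambda>x. x * _"] cong: if_cong)

lemma diag_matrix_mult_vec: "diag_matrix a *v v = a * v" for v :: "'a::field ^ 'n"
  by (simp add: vec_eq_iff diag_matrix_def matrix_vector_mult_def if_distrib[of "\<lambda>x. x * _"] cong: if_cong)

lemma invertible_diag_matrix:
  fixes a :: "'a::field ^ 'n"
  assumes "\<And>i. a $ i \<noteq> 0"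
  shows "invertible (diag_matrix a)"
  using assms det_diagonal[of "diag_matrix a"] by (simp add: invertible_det_nz diag_matrix_def)

lemma deg_le_matrix_mult:
  fixes A B :: "'a::field fls ^ 'n ^ 'n"
  assumes "\<And>j. deg_le (A $ i $ j) m" "\<And>j. deg_le (B $ j $ l) n"
  shows "deg_le ((A ** B) $ i $ l) (m + n)"
  using assms by (auto simp: matrix_matrix_mult_def intro!: deg_le_sum deg_le_mult)

lemma deg_le_matrix_vector_mult:
  fixes A :: "'a::field fls ^ 'n ^ 'n"
  assumes "\<And>j. deg_le (A $ i $ j) m" "\<And>j. deg_le (v $ j) n"
  shows "deg_le ((A *v v) $ i) (m + n)"
  using assms by (auto simp: matrix_vector_mult_def intro!: deg_le_sum deg_le_mult)

text \<open>Write \<open>v = h' P v - h' (P - h) v\<close>. If \<open>v\<close> exceeded the bound,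
  both terms would have degree below the maximal degree \<open>M\<close> of \<open>v\<close>, a
  contradiction.\<close>

lemma near_invertible_bound:
  fixes h h' P :: "'a::field fls ^ 'n ^ 'n"
  assumes h: "h' ** h = mat 1" "\<And>i j. deg_le (h' $ i $ j) c"
    and P: "\<And>i j. deg_le (P $ i $ j - h $ i $ j) (- n)" and n: "c < n"
    and v: "\<And>i. deg_le ((P *v v) $ i) m"
  shows "deg_le (v $ i) (c + m)"
proof (rule ccontr)
  assume i: "\<not> deg_le (v $ i) (c + m)"
  define M where "M = Max ((\<lambda>i. deg (v $ i)) ` {i. v $ i \<noteq> 0})"
  have "v $ i \<noteq> 0" using i by auto
  then have ne: "{i. v $ i \<noteq> 0} \<noteq> {}" by blast
  have "M \<in> (\<lambda>i. deg (v $ i)) ` {i. v $ i \<noteq> 0}"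
    unfolding M_def using ne by (intro Max_in) auto
  then obtain j where j: "v $ j \<noteq> 0" "deg (v $ j) = M" by auto
  have M: "deg_le (v $ l) M" for l
    by (cases "v $ l = 0") (auto simp: deg_le_iff M_def)
  have big: "c + m < M"
    using i M[of i] by (auto simp: deg_le_iff)
  have "v = h' *v (h *v v)" by (simp add: matrix_vector_mul_assoc h)
  also have "h *v v = P *v v - (P - h) *v v" by (simp add: matrix_vector_mult_diff_rdistrib)
  finally have "v $ j = (h' *v (P *v v)) $ j - (h' *v ((P - h) *v v)) $ j"
    by (metis matrix_vector_mult_diff_distrib vector_minus_component)
  moreover have "deg_le ((h' *v (P *v v)) $ j) (M - 1)"
    using deg_le_matrix_vector_mult[OF h(2) v, of j] big by (auto elim: deg_le_mono)
  moreover have "deg_le ((h' *v ((P - h) *v v)) $ j) (c + (- n + M))"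
    using P M by (intro deg_le_matrix_vector_mult h(2)) auto
  then have "deg_le ((h' *v ((P - h) *v v)) $ j) (M - 1)"
    by (rule deg_le_mono) (use n in simp)
  ultimately have "deg_le (v $ j) (M - 1)" by (simp add: deg_le_diff)
  then show False using j by (simp add: deg_le_iff)
qed

section \<open>Translates of the order near a fixed lattice\<close>

context split_order
begin

text \<open>\<open>\<gamma>\<close> is the base change from \<open>P\<close> to the Newton basis
  \<open>A\<close> of the normalised translate. The bound \<open>B\<close> involves only
  \<open>c0\<close>, \<open>c1\<close> and \<open>d\<close>, so finitely many
  \<open>\<gamma>\<close> suffice as \<open>k\<close> and \<open>n\<close> grow.\<close>

lemma near_diagonal:
  fixes h h' P :: "'a fls ^ 'n ^ 'n"
  assumes h: "h' ** h = mat 1" "\<And>i j. deg_le (h $ i $ j) c0" "\<And>i j. deg_le (h' $ i $ j) c1"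
    and c: "0 \<le> c0" "0 \<le> c1"
    and P: "\<And>i j. deg_le (P $ i $ j - h $ i $ j) (- n)" and n: "c1 < n" "n \<le> k"
    and f: "bij_betw f UNIV {..<CARD('n)}"
    and a: "\<And>i. a $ i \<noteq> 0"
    and eq: "(\<lambda>v. P *v v) ` standard_lattice = (*) a ` order_lattice f"
  defines "B \<equiv> c1 + (d * c0 + (d - 1) * (c1 + d\<^sup>2)) + d\<^sup>2"
  shows "\<exists>\<gamma>\<in>GL_polys. (\<forall>i j. deg_le (\<gamma> $ i $ j) B) \<and> (\<forall>i j. i \<noteq> j \<longrightarrow> deg_le ((h ** \<gamma>) $ i $ j) (B - n))"
proof -
  obtain b where b0: "\<And>i. b $ i \<noteq> 0" and b: "(*) b ` order_lattice f = (*) a ` order_lattice f"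
    and range: "\<And>i l. deg (b $ i) - deg (b $ l) \<le> k * d"
    using normalize_diag[OF f a] by blast
  define \<tau> where "\<tau> i = deg (b $ i)" for i
  obtain g where g: "bij_betw g UNIV {..<CARD('n)}" and sorted: "\<And>i j. g i < g j \<Longrightarrow> \<tau> j \<le> \<tau> i"
    using ex_sorting_enumeration by blast
  let ?W = "newton g"
  define A where "A = diag_matrix b ** ?W"
  have A: "A $ i $ j = b $ i * ?W $ i $ j" for i j
    by (simp add: A_def diag_matrix_mult_component)
  have "A *v v = b * (?W *v v)" for v
    by (simp add: A_def diag_matrix_mult_vec flip: matrix_vector_mul_assoc)
  moreover have "(\<lambda>v. P *v v) ` standard_lattice = (*) b ` order_lattice g"
    using eq b order_lattice_indep[OF f g] by simp
  ultimately have AP: "(\<lambda>v. A *v v) ` standard_lattice = (\<lambda>v. P *v v) ` standard_lattice"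
    by (simp add: order_lattice_def image_image)
  \<comment> \<open>\<open>D j\<close> is the degree of the \<open>j\<close>th diagonal entry of \<open>A\<close>; up to \<open>d\<^sup>2\<close> it is also that of the whole
    column. Short vectors bound it from below, the determinant then bounds it from above.\<close>
  define D where "D j = \<tau> j + deg (?W $ j $ j)" for j
  have "det A = (\<Prod>i\<in>UNIV. b $ i) * det ?W"
    unfolding A_def det_mul by (subst det_diagonal) (auto simp: diag_matrix_def)
  then have detA: "det A \<noteq> 0" "deg (det A) = (\<Sum>j\<in>UNIV. D j)"
    using b0 det_newton[OF g] by (simp_all add: deg_mult deg_prod D_def \<tau>_def sum.distrib)
  then have "invertible A" using invertible_det_nz by blast
  then obtain \<gamma> \<gamma>' where GL: "\<gamma> \<in> GL_polys" and \<gamma>: "\<And>i j. \<gamma> $ i $ j \<in> polys" "P ** \<gamma> = A"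
    and \<gamma>': "\<And>i j. \<gamma>' $ i $ j \<in> polys" "A ** \<gamma>' = P" and inv: "\<gamma>' ** \<gamma> = mat 1"
    using standard_lattice_image_eq[OF _ AP] by blast
  \<comment> \<open>\<open>det \<gamma>'\<close> is a nonzero polynomial, hence of degree at least
    0, so the degree of \<open>det A\<close> is at most that of \<open>det P\<close>.\<close>
  have "det \<gamma>' * det \<gamma> = 1" using inv by (metis det_I det_mul)
  then have "det \<gamma>' \<noteq> 0" by auto
  then have "0 \<le> deg (det \<gamma>')" by (intro polys_deg_nonneg polys_det \<gamma>')
  moreover have "deg (det P) = deg (det A) + deg (det \<gamma>')" "det P \<noteq> 0"
    using detA \<open>det \<gamma>' \<noteq> 0\<close> unfolding \<gamma>'(2)[symmetric] det_mul by (auto simp: deg_mult)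
  moreover have "deg_le (det P) (d * c0)"
  proof -
    have Pc: "deg_le (P $ i $ j) c0" for i j
    proof -
      have "deg_le (P $ i $ j - h $ i $ j) c0" by (rule deg_le_mono[OF P]) (use c n in linarith)
      from deg_le_add[OF this h(2)[of i j]] show ?thesis by simp
    qed
    have "deg_le (\<Prod>i\<in>UNIV. P $ i $ p i) (\<Sum>i\<in>(UNIV::'n set). c0)" for p
      by (intro deg_le_prod Pc)
    then have "deg_le (of_int (sign p) * (\<Prod>i\<in>UNIV. P $ i $ p i)) (d * c0)" for p
      by (cases "evenperm p") (auto simp: sign_def)
    then show ?thesis unfolding det_def by (intro deg_le_sum)
  qed
  ultimately have sumD: "(\<Sum>j\<in>UNIV. D j) \<le> d * c0"
    using detA by (auto simp: deg_le_iff)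
  have W_diag: "k * int (g j) \<le> deg (?W $ j $ j)" for j
    using deg_newton_lower_ge[OF g, of j j] by simp
  have d2: "0 \<le> d\<^sup>2" by simp
  have low: "deg (A $ l $ j) \<le> \<tau> l + k * int (g j) + d\<^sup>2" if "g j \<le> g l" for l j
    using deg_newton_lower_le[OF g that] b0 newton_nonzero by (simp add: A deg_mult \<tau>_def)
  have high: "deg (A $ l $ j) \<le> \<tau> l + k * int (g j) - k * d" if "g l < g j" for l j
    using deg_newton_upper_le[OF g that] b0 newton_nonzero by (simp add: A deg_mult \<tau>_def)
  \<comment> \<open>Below the diagonal, sortedness gives the bound; above it, the gain
    \<open>k * d\<close> of the Newton entry offsets the spread of the degrees of
    \<open>b\<close>.\<close>
  have col: "deg (A $ l $ j) \<le> D j + d\<^sup>2" for l j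
  proof (cases "g j \<le> g l")
    case True
    then have "\<tau> l \<le> \<tau> j" using sorted[of j l] enum_inj[OF g, of j l] by (cases "g j = g l") auto
    then show ?thesis using low[OF True] W_diag[of j] by (simp add: D_def)
  next
    case False
    then show ?thesis
      using high[of l j] range[of l j] W_diag[of j] d2 unfolding D_def \<tau>_def by linarith
  qed
  have A0: "A $ i $ j \<noteq> 0" for i j using b0 newton_nonzero by (simp add: A)
  have P\<gamma>: "P *v (\<chi> i. \<gamma> $ i $ j) = (\<chi> i. A $ i $ j)" for j
    by (simp add: vec_eq_iff \<gamma>(2)[symmetric] matrix_matrix_mult_def matrix_vector_mult_def)
  have \<gamma>_bound: "deg_le (\<gamma> $ i $ j) (c1 + m)" if "\<And>l. deg (A $ l $ j) \<le> m" for i j m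
  proof -
    have "deg_le ((P *v (\<chi> i. \<gamma> $ i $ j)) $ l) m" for l
      using that by (simp add: P\<gamma> deg_le_iff)
    from near_invertible_bound[OF h(1) h(3) P n(1) this, of i] show ?thesis by simp
  qed
  have D_lower: "- (c1 + d\<^sup>2) \<le> D j" for j
  proof -
    \<comment> \<open>A nonzero polynomial entry has degree at least 0, which keeps the column of
      \<open>A\<close> from being too short.\<close>
    have "\<exists>i. \<gamma> $ i $ j \<noteq> 0"
    proof (rule ccontr)
      assume "\<not> ?thesis"
      then have "(\<gamma>' ** \<gamma>) $ j $ j = 0" by (simp add: matrix_matrix_mult_def)
      then show False by (simp add: inv mat_def)
    qed
    then obtain i where i: "\<gamma> $ i $ j \<noteq> 0" ..
    then have "0 \<le> deg (\<gamma> $ i $ j)" by (intro polys_deg_nonneg \<gamma>)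
    then show ?thesis using \<gamma>_bound[OF col, of i j] i by (simp add: deg_le_iff)
  qed
  define E where "E = d * c0 + (d - 1) * (c1 + d\<^sup>2)"
  have D_upper: "D j \<le> E" for j
  proof -
    have "(\<Sum>i\<in>UNIV. D i) = D j + (\<Sum>i\<in>-{j}. D i)"
      using sum.remove[of UNIV j D] by (simp add: Compl_eq_Diff_UNIV)
    moreover have "int (card (-{j})) * - (c1 + d\<^sup>2) \<le> (\<Sum>i\<in>-{j}. D i)"
      using D_lower by (intro sum_bounded_below) auto
    moreover have "int (card (- {j})) = d - 1"
      using d_pos by (simp add: Compl_eq_Diff_UNIV card_Diff_singleton of_nat_diff)
    ultimately show ?thesis using sumD by (simp add: E_def algebra_simps)
  qed
  have \<tau>_upper: "\<tau> j \<le> E - k * int (g j)" for j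
    using D_upper[of j] W_diag[of j] by (simp add: D_def)
  have \<gamma>B: "deg_le (\<gamma> $ i $ j) B" for i j
  proof -
    have "deg (A $ l $ j) \<le> E + d\<^sup>2" for l
      using col[of l j] D_upper[of j] by linarith
    from \<gamma>_bound[OF this] show ?thesis by (simp add: B_def E_def add.assoc)
  qed
  have off: "deg_le (A $ l $ j) (B - n)" if "l \<noteq> j" for l j
  proof -
    \<comment> \<open>The bound on \<open>\<tau> l\<close> saves at least one \<open>k\<close>:
      below the diagonal because \<open>g j < g l\<close>, above it because
      \<open>g j < g l + d\<close>.\<close>
    have "deg (A $ l $ j) \<le> E + d\<^sup>2 - k"
    proof (cases "g j \<le> g l")
      case True
      then have "int (g j) + 1 \<le> int (g l)" using that enum_inj[OF g, of j l] by auto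
      then have "k * (int (g j) + 1) \<le> k * int (g l)" using k_pos by (intro mult_left_mono) auto
      then show ?thesis using low[OF True] \<tau>_upper[of l] by (simp add: algebra_simps)
    next
      case False
      have "g j < CARD('n)" by (rule enum_less[OF g])
      then have "int (g j) + 1 \<le> d" using d_eq by linarith
      then have "int (g j) + 1 \<le> int (g l) + d" by linarith
      then have "k * (int (g j) + 1) \<le> k * (int (g l) + d)" using k_pos by (intro mult_left_mono) auto
      moreover have "k * (int (g j) + 1) = k * int (g j) + k" by (simp add: algebra_simps)
      moreover have "k * (int (g l) + d) = k * int (g l) + k * d" by (simp add: algebra_simps)
      ultimately show ?thesis using high[of l j] False \<tau>_upper[of l] d2 by linarith
    qed
    then show ?thesis using n c A0 by (simp add: deg_le_iff B_def E_def)
  qed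
  have "deg_le ((h ** \<gamma>) $ i $ j) (B - n)" if "i \<noteq> j" for i j
  proof -
    \<comment> \<open>As \<open>\<gamma>\<close> is bounded, passing from \<open>P\<close> to
      \<open>h\<close> costs only degree \<open>B - n\<close>.\<close>
    have "h ** \<gamma> = A - (P - h) ** \<gamma>"
      by (simp add: \<gamma>(2)[symmetric] vec_eq_iff matrix_matrix_mult_def left_diff_distrib sum_subtractf)
    moreover have "deg_le (((P - h) ** \<gamma>) $ i $ j) (- n + B)"
      using P by (intro deg_le_matrix_mult \<gamma>B) auto
    ultimately show ?thesis using off[OF that] by (simp add: deg_le_diff)
  qed
  then show ?thesis using GL \<gamma>B by blast
qed

end

section \<open>The space of lattices\<close>

definition lattice_class :: "'a::field fls ^ 'n ^ 'n \<Rightarrow> ('a fls ^ 'n) set set" where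
  "lattice_class g = homothety_class ((\<lambda>v. g *v v) ` standard_lattice)"

lemma homothety_class_smult:
  fixes L :: "('a::field fls ^ 'n) set"
  assumes "c \<noteq> 0"
  shows "homothety_class ((\<lambda>v. c *s v) ` L) = homothety_class L"
proof -
  have "proj (mat 1 :: 'a fls ^ 'n ^ 'n) = proj (mat c)"
    using assms by (auto simp: proj_eq_iff)
  then have "act (proj (mat 1 :: 'a fls ^ 'n ^ 'n)) (homothety_class L) = act (proj (mat c)) (homothety_class L)"
    by simp
  then show ?thesis by (simp add: act_proj mat_mult_vec)
qed

lemma homothety_class_eqD:
  assumes "homothety_class L = homothety_class M"
  obtains c where "c \<noteq> 0" "L = (\<lambda>v. c *s v) ` M"
proof -
  have "L \<in> homothety_class L"
    by (auto simp: homothety_class_def intro!: exI[of _ 1])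
  then have "L \<in> homothety_class M" using assms by simp
  then show ?thesis using that by (auto simp: homothety_class_def)
qed

text \<open>Two successive quotients compose to one, so the topology can be handled with matrices
  instead of classes in \<open>PGL\<close>.\<close>

lemma quotient_map_lattice_class:
  "quotient_map (subtopology euclidean (carrier GL)) lattice_topology lattice_class"
proof -
  have "(\<lambda>P. act P (homothety_class standard_lattice)) \<circ> proj = lattice_class"
    by (auto simp: act_proj lattice_class_def)
  then show ?thesis
    using quotient_map_compose[OF quotient_map_quotient_topology quotient_map_quotient_topology]
    unfolding lattice_topology_def PGL_topology_def by metis
qed

lemma ex_deg_bound:
  fixes g :: "'a::field fls ^ 'n ^ 'm"
  obtains m where "0 \<le> m" "\<And>i j. deg_le (g $ i $ j) m"
proof -
  define m where "m = Max (insert 0 (range (\<lambda>(i, j). deg (g $ i $ j))))"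
  have "deg (g $ i $ j) \<le> m" for i j
    unfolding m_def by (rule Max_ge) (auto intro: rev_image_eqI[of "(i, j)"])
  moreover have "0 \<le> m" unfolding m_def by (rule Max_ge) auto
  ultimately show ?thesis using that by (simp add: deg_le_iff)
qed

lemma lattice_class_mult_GL_polys:
  assumes "\<gamma> \<in> GL_polys"
  shows "lattice_class (g ** \<gamma>) = lattice_class g"
proof -
  have "invertible \<gamma>" using assms by (auto simp: GL_polys_def invertible_def)
  then have "(\<lambda>v. \<gamma> *v v) ` standard_lattice = standard_lattice"
    using assms GL_polys_iff by blast
  moreover have "(\<lambda>v. (g ** \<gamma>) *v v) ` standard_lattice
    = (\<lambda>v. g *v v) ` ((\<lambda>v. \<gamma> *v v) ` standard_lattice)"
    by (simp add: image_image matrix_vector_mul_assoc)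
  ultimately show ?thesis by (simp add: lattice_class_def)
qed

lemma lattice_class_scalar:
  assumes "c \<noteq> 0"
  shows "lattice_class (mat c ** g) = lattice_class g"
proof -
  have "(\<lambda>v. (mat c ** g) *v v) ` standard_lattice = (\<lambda>v. c *s v) ` ((\<lambda>v. g *v v) ` standard_lattice)"
    by (simp add: image_image mat_mult_vec flip: matrix_vector_mul_assoc)
  then show ?thesis by (simp add: lattice_class_def homothety_class_smult assms)
qed

lemma lattice_class_eqD:
  fixes g u :: "'a::field fls ^ 'n ^ 'n"
  assumes "invertible u" "lattice_class u = lattice_class g"
  obtains c \<gamma> where "c \<noteq> 0" "\<gamma> \<in> GL_polys" "u = mat c ** g ** \<gamma>"
proof -
  obtain c where c: "c \<noteq> 0"
    "(\<lambda>v. u *v v) ` standard_lattice = (\<lambda>v. c *s v) ` ((\<lambda>v. g *v v) ` standard_lattice)"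
    using assms(2) homothety_class_eqD unfolding lattice_class_def by metis
  then have "(\<lambda>v. u *v v) ` standard_lattice = (\<lambda>v. (mat c ** g) *v v) ` standard_lattice"
    by (simp add: image_image mat_mult_vec flip: matrix_vector_mul_assoc)
  from standard_lattice_image_eq[OF assms(1) this] show ?thesis
    using that c(1) by metis
qed

text \<open>The preimage of the image is a union of translates of \<open>U\<close> by scalars and by
  \<open>GL_polys\<close>. Openness lets lattices near a limit be represented by matrices near a
  given representative.\<close>

lemma open_map_lattice_class:
  fixes U :: "('a::field fls ^ 'n ^ 'n) set"
  assumes "openin (subtopology euclidean (carrier GL)) U"
  shows "openin lattice_topology (lattice_class ` U)"
proof -
  let ?X = "subtopology euclidean (carrier GL) :: ('a fls ^ 'n ^ 'n) topology"
  obtain V where V: "open V" "U = V \<inter> carrier GL"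
    using assms by (auto simp: openin_subtopology)
  have "openin ?X {g \<in> topspace ?X. lattice_class g \<in> lattice_class ` U}"
  proof (subst openin_subopen, intro ballI)
    fix g assume "g \<in> {g \<in> topspace ?X. lattice_class g \<in> lattice_class ` U}"
    then obtain u where g: "g \<in> carrier GL" and u: "u \<in> U" "lattice_class g = lattice_class u" by auto
    have "invertible u" using u V by (auto simp: GL_def)
    then obtain c \<gamma> where c: "c \<noteq> 0" and \<gamma>: "\<gamma> \<in> GL_polys" and eq: "u = mat c ** g ** \<gamma>"
      using lattice_class_eqD[of u g] u(2) by metis
    obtain n :: nat where n: "\<And>y. (\<And>i j. deg_le (y $ i $ j - u $ i $ j) (- int n)) \<Longrightarrow> y \<in> V"
      using V u(1) unfolding open_mat_iff by blast
    obtain m where m: "0 \<le> m" "\<And>i j. deg_le (\<gamma> $ i $ j) m" using ex_deg_bound by blast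
    \<comment> \<open>Multiplying by \<open>c\<close> and \<open>\<gamma>\<close> raises degrees by
      at most \<open>deg c + m\<close>.\<close>
    define N where "N = nat (int n + m + \<bar>deg c\<bar>)"
    define W where "W = {g'. \<forall>i j. deg_le (g' $ i $ j - g $ i $ j) (- int N)}"
    have "open W" unfolding W_def by (rule open_mat_ball)
    moreover have "lattice_class g' \<in> lattice_class ` U" if g': "g' \<in> W" "g' \<in> carrier GL" for g'
    proof -
      let ?u = "mat c ** g' ** \<gamma>"
      have "?u $ i $ j - u $ i $ j = (mat c ** (g' - g) ** \<gamma>) $ i $ j" for i j
        by (simp add: eq matrix_matrix_mult_def left_diff_distrib right_diff_distrib sum_subtractf)
      moreover have "deg_le ((mat c ** (g' - g) ** \<gamma>) $ i $ j) ((deg c - int N) + m)" for i j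
      proof (rule deg_le_matrix_mult[OF _ m(2)])
        fix j show "deg_le ((mat c ** (g' - g)) $ i $ j) (deg c - int N)"
          using deg_le_mult[OF deg_le_deg[of c], of "(g' - g) $ i $ j" "- int N"] g'(1)
          by (simp add: mat_mult_component W_def)
      qed
      moreover have "deg c - int N + m \<le> - int n" using m(1) by (simp add: N_def)
      ultimately have "?u \<in> V" by (intro n) (metis deg_le_mono)
      moreover have "invertible ?u"
        using g'(2) \<gamma> c by (intro invertible_mult invertible_mat) (auto simp: GL_def GL_polys_def invertible_def)
      moreover have "lattice_class ?u = lattice_class g'"
        by (simp add: lattice_class_mult_GL_polys[OF \<gamma>] lattice_class_scalar[OF c])
      ultimately show ?thesis using V(2) by (auto simp: GL_def intro: rev_image_eqI[of ?u])
    qed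
    moreover have "g \<in> W" by (simp add: W_def)
    ultimately show "\<exists>T. openin ?X T \<and> g \<in> T \<and> T \<subseteq> {g \<in> topspace ?X. lattice_class g \<in> lattice_class ` U}"
      using g by (intro exI[of _ "W \<inter> carrier GL"]) (auto simp: openin_subtopology)
  qed
  moreover have "lattice_class ` U \<subseteq> topspace lattice_topology"
    using V(2) quotient_imp_surjective_map[OF quotient_map_lattice_class] by auto
  ultimately show ?thesis
    using quotient_map_lattice_class unfolding quotient_map_def by blast
qed

section \<open>Compactness of diagonal orbits\<close>

lemma PDiag_cases:
  assumes "P \<in> PDiag"
  obtains a :: "'a::field fls ^ 'n" where "\<And>i. a $ i \<noteq> 0"
    "\<And>L. act P (homothety_class L) = homothety_class ((*) a ` L)"
proof -
  obtain g where g: "P = proj g" "invertible g" "\<And>i j. i \<noteq> j \<Longrightarrow> g $ i $ j = 0"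
    using assms by (auto simp: PDiag_def)
  define a where "a = (\<chi> i. g $ i $ i)"
  have "det g \<noteq> 0" using g(2) invertible_det_nz by blast
  then have "a $ i \<noteq> 0" for i
    using det_diagonal[of g] g(3) by (simp add: a_def)
  moreover have "g *v v = a * v" for v
  proof -
    have "(\<Sum>j\<in>UNIV. g $ i $ j * v $ j) = (\<Sum>j\<in>UNIV. if j = i then g $ i $ i * v $ i else 0)" for i
      using g(3) by (intro sum.cong) auto
    then show ?thesis by (simp add: vec_eq_iff matrix_vector_mult_def a_def)
  qed
  then have "act P (homothety_class L) = homothety_class ((*) a ` L)" for L
    by (simp add: g(1) act_proj)
  ultimately show ?thesis using that by blast
qed

lemma diag_matrix_PDiag:
  fixes a :: "'a::field fls ^ 'n"
  assumes "\<And>i. a $ i \<noteq> 0"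
  shows "proj (diag_matrix a) \<in> PDiag"
  unfolding PDiag_def using invertible_diag_matrix[OF assms] by (auto simp: diag_matrix_def)

context split_order
begin

lemma lattice_class_diag_newton:
  "lattice_class (diag_matrix b ** newton f) = homothety_class ((*) b ` order_lattice f)"
  by (simp add: lattice_class_def order_lattice_def image_image diag_matrix_mult_vec
      flip: matrix_vector_mul_assoc)

lemma invertible_newton: "bij_betw f UNIV {..<CARD('n)} \<Longrightarrow> invertible (newton f)"
  using det_newton(1) by (simp add: invertible_det_nz)

end

text \<open>By \<open>normalize_diag\<close> and a homothety, diagonal entries of degree between 0
  and \<open>k * d\<close> already cover the orbit. They form a compact box, and the orbit is its
  continuous image.\<close>

lemma compactin_diag_orbit:
  fixes Q \<theta> :: "'n::finite \<Rightarrow> 'a::{field,finite} fls"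
  assumes "split_order Q \<theta> k d" and f: "bij_betw f UNIV {..<CARD('n)}"
  shows "compactin lattice_topology (diag_orbit (homothety_class (split_order.order_lattice Q \<theta> f)))"
proof -
  interpret split_order Q \<theta> k d by fact
  let ?L = "order_lattice f"
  let ?X = "product_topology (\<lambda>_::'n. euclidean :: 'a fls topology) UNIV"
  \<comment> \<open>Removing the elements of degree at most -1 removes 0 as well, which keeps the
    matrices invertible.\<close>
  let ?S = "{z :: 'a fls. deg_le z (k * d)} - {z. deg_le z (- 1)}"
  let ?F = "\<lambda>b::'n \<Rightarrow> 'a fls. diag_matrix (\<chi> i. b i) ** newton f"
  have S: "z \<in> ?S \<longleftrightarrow> z \<noteq> 0 \<and> 0 \<le> deg z \<and> deg z \<le> k * d" for z
    by (auto simp: deg_le_iff)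
  have "compactin ?X (PiE UNIV (\<lambda>_. ?S))"
    using compact_diff[OF compact_deg_le open_deg_le] by (auto simp: compactin_PiE)
  moreover have "continuous_map ?X euclidean ?F"
    unfolding continuous_map_def
  proof (intro conjI allI impI)
    fix U :: "('a fls ^ 'n ^ 'n) set" assume "openin euclidean U"
    then have U: "open U" by simp
    obtain m where m: "0 \<le> m" "\<And>i j. deg_le (newton f $ i $ j) m" using ex_deg_bound by blast
    show "openin ?X {b \<in> topspace ?X. ?F b \<in> U}"
    proof (subst openin_subopen, intro ballI)
      fix b assume "b \<in> {b \<in> topspace ?X. ?F b \<in> U}"
      then obtain n :: nat
        where n: "\<And>y. (\<And>i j. deg_le (y $ i $ j - ?F b $ i $ j) (- int n)) \<Longrightarrow> y \<in> U"
        using U unfolding open_mat_iff by blast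
      define A where "A i = {z. deg_le (z - b i) (- (int n + m))}" for i
      have "open (A i)" for i
      proof -
        have "open ((\<lambda>z. z - b i) -` {z. deg_le z (- (int n + m))})"
        proof (subst open_fls_iff, intro ballI)
          fix x assume "x \<in> (\<lambda>z. z - b i) -` {z. deg_le z (- (int n + m))}"
          then have x: "deg_le (x - b i) (- (int n + m))" by simp
          have "deg_le (y - b i) (- (int n + m))" if "deg_le (y - x) (- int (nat (int n + m)))" for y
            using deg_le_add[OF x, of "y - x"] that m(1) by simp
          then show "\<exists>l. \<forall>y. deg_le (y - x) (- int l) \<longrightarrow> y \<in> (\<lambda>z. z - b i) -` {z. deg_le z (- (int n + m))}"
            by blast
        qed
        then show ?thesis by (simp add: A_def vimage_def)
      qed
      then have "openin ?X (PiE UNIV A)" by (intro product_topology_basis) auto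
      moreover have "?F b' \<in> U" if "b' \<in> PiE UNIV A" for b'
      proof (rule n)
        fix i j
        have "deg_le (b' i - b i) (- (int n + m))" using that by (auto simp: A_def PiE_iff)
        from deg_le_mult[OF this m(2)[of i j]]
        show "deg_le (?F b' $ i $ j - ?F b $ i $ j) (- int n)"
          by (simp add: diag_matrix_mult_component algebra_simps)
      qed
      ultimately show "\<exists>T. openin ?X T \<and> b \<in> T \<and> T \<subseteq> {b \<in> topspace ?X. ?F b \<in> U}"
        by (intro exI[of _ "PiE UNIV A"]) (auto simp: A_def)
    qed
  qed auto
  ultimately have "compactin euclidean (?F ` PiE UNIV (\<lambda>_. ?S))"
    by (rule image_compactin)
  moreover have "?F ` PiE UNIV (\<lambda>_. ?S) \<subseteq> carrier GL"
  proof (rule image_subsetI)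
    fix b assume "b \<in> PiE UNIV (\<lambda>_::'n. ?S)"
    then have "b i \<noteq> 0" for i using S by (auto simp: PiE_iff)
    then show "?F b \<in> carrier GL"
      by (auto simp: GL_def intro!: invertible_mult invertible_diag_matrix invertible_newton f)
  qed
  ultimately have "compactin (subtopology euclidean (carrier GL)) (?F ` PiE UNIV (\<lambda>_. ?S))"
    by (simp add: compactin_subtopology)
  then have "compactin lattice_topology (lattice_class ` ?F ` PiE UNIV (\<lambda>_. ?S))"
    by (rule image_compactin[OF _ quotient_imp_continuous_map[OF quotient_map_lattice_class]])
  moreover have "lattice_class ` ?F ` PiE UNIV (\<lambda>_. ?S) = diag_orbit (homothety_class ?L)"
  proof (intro equalityI subsetI)
    fix y assume "y \<in> lattice_class ` ?F ` PiE UNIV (\<lambda>_. ?S)"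
    then obtain b where b: "b \<in> PiE UNIV (\<lambda>_. ?S)" and y: "y = lattice_class (?F b)" by auto
    have "(\<chi> i. b i) $ i \<noteq> 0" for i using b S by (auto simp: PiE_iff)
    then have "proj (diag_matrix (\<chi> i. b i)) \<in> PDiag" by (rule diag_matrix_PDiag)
    moreover have "y = act (proj (diag_matrix (\<chi> i. b i))) (homothety_class ?L)"
      by (simp add: y act_proj lattice_class_diag_newton diag_matrix_mult_vec)
    ultimately show "y \<in> diag_orbit (homothety_class ?L)" unfolding diag_orbit_def by blast
  next
    fix y assume "y \<in> diag_orbit (homothety_class ?L)"
    then obtain P where "P \<in> PDiag" "y = act P (homothety_class ?L)" by (auto simp: diag_orbit_def)
    then obtain a where a: "\<And>i. a $ i \<noteq> 0" and y: "y = homothety_class ((*) a ` ?L)"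
      using PDiag_cases by metis
    obtain b where b: "\<And>i. b $ i \<noteq> 0" "(*) b ` ?L = (*) a ` ?L"
      "\<And>i l. deg (b $ i) - deg (b $ l) \<le> k * d"
      using normalize_diag[OF f a] by blast
    have fin: "finite (range (\<lambda>i. deg (b $ i)))" "range (\<lambda>i. deg (b $ i)) \<noteq> {}" by auto
    obtain q where q: "deg (b $ q) = Min (range (\<lambda>i. deg (b $ i)))"
      using Min_in[OF fin] by (metis imageE)
    then have q_le: "deg (b $ q) \<le> deg (b $ i)" for i using fin by auto
    \<comment> \<open>Dividing by an entry of smallest degree moves all degrees, whose spread is at
      most \<open>k * d\<close>, into the box.\<close>
    define c where "c = inverse (b $ q)"
    have c: "c \<noteq> 0" "deg c = - deg (b $ q)" using b(1) by (simp_all add: c_def deg_inverse)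
    have "c * b $ i \<in> ?S" for i
      unfolding S using b(1)[of i] b(3)[of i q] c q_le[of i] by (simp add: deg_mult)
    then have "(\<lambda>i. c * b $ i) \<in> PiE UNIV (\<lambda>_. ?S)" by (intro PiE_I) auto
    moreover have "y = lattice_class (?F (\<lambda>i. c * b $ i))"
    proof -
      have "(*) (\<chi> i. c * b $ i) ` ?L = (\<lambda>v. c *s v) ` ((*) b ` ?L)"
        by (simp add: image_image) (rule image_cong, simp_all add: vec_eq_iff mult.assoc)
      then show ?thesis
        using c(1) by (simp add: lattice_class_diag_newton homothety_class_smult y b(2))
    qed
    ultimately show "y \<in> lattice_class ` ?F ` PiE UNIV (\<lambda>_. ?S)" by blast
  qed
  ultimately show ?thesis by simp
qed

section \<open>Limits of diagonal translates\<close>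

lemma finite_vec_set: "finite S \<Longrightarrow> finite {v :: 'a ^ 'n. \<forall>i. v $ i \<in> S}"
  by (rule finite_subset[of _ "vec_lambda ` PiE UNIV (\<lambda>_. S)"])
     (auto intro!: finite_imageI finite_PiE rev_image_eqI[of "vec_nth _"] simp: PiE_iff)

lemma finite_GL_polys_deg_le:
  "finite {\<gamma> \<in> (GL_polys :: ('a::{field,finite} fls ^ 'n ^ 'n) set). \<forall>i j. deg_le (\<gamma> $ i $ j) B}"
proof (rule finite_subset)
  let ?S = "{p :: 'a fls. p \<in> polys \<and> deg_le p (int (nat B))}"
  show "finite {\<gamma> :: 'a fls ^ 'n ^ 'n. \<forall>i. \<gamma> $ i \<in> {v. \<forall>j. v $ j \<in> ?S}}"
    by (intro finite_vec_set finite_polys_deg_le)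
  show "{\<gamma> \<in> (GL_polys :: ('a fls ^ 'n ^ 'n) set). \<forall>i j. deg_le (\<gamma> $ i $ j) B}
    \<subseteq> {\<gamma>. \<forall>i. \<gamma> $ i \<in> {v. \<forall>j. v $ j \<in> ?S}}"
  proof
    fix \<gamma> :: "'a fls ^ 'n ^ 'n" assume "\<gamma> \<in> {\<gamma> \<in> GL_polys. \<forall>i j. deg_le (\<gamma> $ i $ j) B}"
    then have \<gamma>: "\<gamma> $ i $ j \<in> polys" "deg_le (\<gamma> $ i $ j) B" for i j
      by (auto simp: GL_polys_def)
    have "deg_le (\<gamma> $ i $ j) (int (nat B))" for i j
      by (rule deg_le_mono[OF \<gamma>(2)]) simp
    then show "\<gamma> \<in> {\<gamma>. \<forall>i. \<gamma> $ i \<in> {v. \<forall>j. v $ j \<in> ?S}}"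
      using \<gamma>(1) by simp
  qed
qed

text \<open>Fix a representative \<open>h\<close> of the limit. For every large \<open>n\<close>,
  \<open>near_diagonal\<close> gives a bounded \<open>\<gamma>\<close> with
  \<open>h ** \<gamma>\<close> diagonal up to degree \<open>B - n\<close>. Only finitely many
  \<open>\<gamma>\<close> are available, so one serves infinitely many \<open>n\<close> and makes
  \<open>h ** \<gamma>\<close> exactly diagonal.\<close>

lemma limit_is_diagonal:
  fixes Q \<theta> :: "nat \<Rightarrow> 'n::finite \<Rightarrow> 'a::{field,finite} fls"
  assumes order: "\<And>m. split_order (Q m) (\<theta> m) (k m) d" and k: "\<And>m. int m \<le> k m"
    and f: "bij_betw f UNIV {..<CARD('n)}"
  defines "x \<equiv> \<lambda>m. homothety_class (split_order.order_lattice (Q m) (\<theta> m) f)"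
  assumes a: "\<And>m. a m \<in> PDiag" and r: "strict_mono r"
    and lim: "limitin lattice_topology (\<lambda>m. act (a (r m)) (x (r m))) y sequentially"
  shows "y \<in> diag_orbit (homothety_class standard_lattice)"
proof -
  let ?X = "subtopology euclidean (carrier GL) :: ('a fls ^ 'n ^ 'n) topology"
  have "y \<in> topspace lattice_topology" using lim by (simp add: limitin_def)
  then have "y \<in> lattice_class ` topspace ?X"
    using quotient_imp_surjective_map[OF quotient_map_lattice_class] by metis
  then obtain h where hGL: "h \<in> carrier GL" and y: "y = lattice_class h" by auto
  obtain h' where h': "h ** h' = mat 1" "h' ** h = mat 1"
    using hGL by (auto simp: GL_def invertible_def)
  obtain c0 where c0: "0 \<le> c0" "\<And>i j. deg_le (h $ i $ j) c0" using ex_deg_bound by blast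
  obtain c1 where c1: "0 \<le> c1" "\<And>i j. deg_le (h' $ i $ j) c1" using ex_deg_bound by blast
  define B where "B = c1 + (d * c0 + (d - 1) * (c1 + d\<^sup>2)) + d\<^sup>2"
  \<comment> \<open>The range of \<open>n\<close> starts at \<open>nat c1 + 1\<close> because
    \<open>near_diagonal\<close> requires \<open>c1 < n\<close>.\<close>
  have near: "\<exists>\<gamma>\<in>{\<gamma>\<in>GL_polys. \<forall>i j. deg_le (\<gamma> $ i $ j) B}.
      \<forall>i j. i \<noteq> j \<longrightarrow> deg_le ((h ** \<gamma>) $ i $ j) (B - int n)"
    if n: "n \<in> {nat c1 + 1..}" for n
  proof -
    define V where "V = {g. \<forall>i j. deg_le (g $ i $ j - h $ i $ j) (- int n)}"
    have "open V" unfolding V_def by (rule open_mat_ball)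
    then have "openin ?X (carrier GL \<inter> V)" by (rule openin_open_Int)
    then have "openin lattice_topology (lattice_class ` (carrier GL \<inter> V))"
      by (rule open_map_lattice_class)
    moreover have "y \<in> lattice_class ` (carrier GL \<inter> V)"
      using hGL by (auto simp: y V_def)
    ultimately have "\<forall>\<^sub>F m in sequentially. act (a (r m)) (x (r m)) \<in> lattice_class ` (carrier GL \<inter> V)"
      using lim by (simp add: limitin_def)
    then obtain N where N: "\<And>m. m \<ge> N \<Longrightarrow> act (a (r m)) (x (r m)) \<in> lattice_class ` (carrier GL \<inter> V)"
      unfolding eventually_sequentially by blast
    \<comment> \<open>An index so late that the lattice lies in the neighbourhood and that
      \<open>n \<le> k m\<close>.\<close>
    define m where "m = r (max N n)"
    have "n \<le> m" using seq_suble[OF r, of "max N n"] by (simp add: m_def)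
    obtain P where P: "P \<in> V" "act (a m) (x m) = lattice_class P"
      using N[of "max N n"] by (auto simp: m_def)
    interpret split_order "Q m" "\<theta> m" "k m" d by (rule order)
    obtain b where b: "\<And>i. b $ i \<noteq> 0" "act (a m) (x m) = homothety_class ((*) b ` order_lattice f)"
      using PDiag_cases[OF a[of m]] unfolding x_def by metis
    obtain c where c: "c \<noteq> 0"
      "(\<lambda>v. P *v v) ` standard_lattice = (\<lambda>v. c *s v) ` ((*) b ` order_lattice f)"
      using homothety_class_eqD P(2) b(2) unfolding lattice_class_def by metis
    have "(\<lambda>v. c *s v) ` ((*) b ` order_lattice f) = (*) (c *s b) ` order_lattice f"
      unfolding image_image by (rule image_cong) (simp_all add: vec_eq_iff mult.assoc)
    then have eq: "(\<lambda>v. P *v v) ` standard_lattice = (*) (c *s b) ` order_lattice f"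
      using c(2) by simp
    have cb: "(c *s b) $ i \<noteq> 0" for i using c(1) b(1) by simp
    have "deg_le (P $ i $ j - h $ i $ j) (- int n)" for i j using P(1) by (simp add: V_def)
    moreover have "int n \<le> k m" using k[of m] \<open>n \<le> m\<close> by linarith
    moreover have "c1 < int n" using n by auto
    ultimately have "\<exists>\<gamma>\<in>GL_polys. (\<forall>i j. deg_le (\<gamma> $ i $ j) B) \<and>
        (\<forall>i j. i \<noteq> j \<longrightarrow> deg_le ((h ** \<gamma>) $ i $ j) (B - int n))"
      unfolding B_def by (intro near_diagonal[OF h'(2) c0(2) c1(2) c0(1) c1(1) _ _ _ f cb eq])
    then show ?thesis by blast
  qed
  obtain \<gamma> where \<gamma>: "\<gamma> \<in> GL_polys"
    and inf: "infinite {n \<in> {nat c1 + 1..}. \<forall>i j. i \<noteq> j \<longrightarrow> deg_le ((h ** \<gamma>) $ i $ j) (B - int n)}"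
  proof -
    let ?R = "\<lambda>n \<gamma>. \<forall>i j. i \<noteq> j \<longrightarrow> deg_le ((h ** \<gamma>) $ i $ j) (B - int n)"
    have "\<forall>n\<in>{nat c1 + 1..}. \<exists>\<gamma>\<in>{\<gamma>\<in>GL_polys. \<forall>i j. deg_le (\<gamma> $ i $ j) B}. ?R n \<gamma>"
      by (intro ballI near)
    from pigeonhole_infinite_rel[OF infinite_Ici finite_GL_polys_deg_le this]
    obtain \<gamma> where "\<gamma> \<in> {\<gamma>\<in>GL_polys. \<forall>i j. deg_le (\<gamma> $ i $ j) B}"
      "infinite {n \<in> {nat c1 + 1..}. ?R n \<gamma>}" by (elim bexE)
    then show ?thesis using that by blast
  qed
  have offdiag: "(h ** \<gamma>) $ i $ j = 0" if "i \<noteq> j" for i j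
  proof (rule deg_le_all_imp_0)
    fix N
    obtain n where "n > nat (B - N)" "deg_le ((h ** \<gamma>) $ i $ j) (B - int n)"
      using inf \<open>i \<noteq> j\<close> unfolding infinite_nat_iff_unbounded by blast
    then show "\<exists>m\<le>N. deg_le ((h ** \<gamma>) $ i $ j) m"
      by (intro exI[of _ "B - int n"]) auto
  qed
  have "invertible \<gamma>" using \<gamma> by (auto simp: GL_polys_def invertible_def)
  then have "invertible (h ** \<gamma>)" using hGL by (auto simp: GL_def intro: invertible_mult)
  then have "proj (h ** \<gamma>) \<in> PDiag" using offdiag by (auto simp: PDiag_def)
  moreover have "y = act (proj (h ** \<gamma>)) (homothety_class standard_lattice)"
    using lattice_class_mult_GL_polys[OF \<gamma>, of h] by (simp add: y act_proj lattice_class_def)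
  ultimately show ?thesis by (auto simp: diag_orbit_def)
qed

section \<open>The sequence of lattices\<close>

theorem theorem1p12:
  assumes "CARD('n::finite) \<ge> 2"
  shows "\<exists>x :: nat \<Rightarrow> ('a::{field, finite} fls ^ 'n) set set.
    (\<forall>k. x k \<in> lattice_classes) \<and>
    (\<forall>k. compactin lattice_topology (diag_orbit (x k))) \<and>
    (\<forall>a y r. (\<forall>k. a k \<in> PDiag) \<longrightarrow> strict_mono r \<longrightarrow>
       limitin lattice_topology (\<lambda>k. act (a (r k)) (x (r k))) y sequentially \<longrightarrow>
       y \<in> diag_orbit (homothety_class standard_lattice))"
proof -
  obtain f :: "'n \<Rightarrow> nat" where f: "bij_betw f UNIV {..<CARD('n)}"
    using ex_bij_betw_finite_nat[of "UNIV :: 'n set"] by (auto simp: atLeast0LessThan)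
  \<comment> \<open>The summand \<open>4 * CARD('n)\<^sup>2\<close> meets \<open>k_large\<close>;
    the summand \<open>m\<close> makes the parameter at least \<open>m\<close>, as
    \<open>limit_is_diagonal\<close> demands.\<close>
  have "\<exists>Q \<theta> :: 'n \<Rightarrow> 'a fls. split_order Q \<theta> (int (4 * CARD('n)\<^sup>2 + m)) (int CARD('n))" for m
    by (rule ex_split_order[OF f]) simp
  then obtain Q \<theta> :: "nat \<Rightarrow> 'n \<Rightarrow> 'a fls"
    where order: "\<And>m. split_order (Q m) (\<theta> m) (int (4 * CARD('n)\<^sup>2 + m)) (int CARD('n))"
    by metis
  define x where "x m = homothety_class (split_order.order_lattice (Q m) (\<theta> m) f)" for m
  have "x m \<in> lattice_classes" for m
  proof -
    interpret split_order "Q m" "\<theta> m" "int (4 * CARD('n)\<^sup>2 + m)" "int CARD('n)" by (rule order)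
    show ?thesis
      using invertible_newton[OF f] by (auto simp: lattice_classes_def x_def order_lattice_def GL_def)
  qed
  moreover have "compactin lattice_topology (diag_orbit (x m))" for m
    unfolding x_def by (rule compactin_diag_orbit[OF order f])
  moreover have "y \<in> diag_orbit (homothety_class standard_lattice)"
    if "\<forall>m. a m \<in> PDiag" "strict_mono r"
      "limitin lattice_topology (\<lambda>m. act (a (r m)) (x (r m))) y sequentially" for a y r
  proof (rule limit_is_diagonal[where Q = Q and \<theta> = \<theta> and a = a and r = r and f = f])
    show "split_order (Q m) (\<theta> m) (int (4 * CARD('n)\<^sup>2 + m)) (int CARD('n))" for m
      by (rule order)
    show "limitin lattice_topology
        (\<lambda>m. act (a (r m)) (homothety_class (split_order.order_lattice (Q (r m)) (\<theta> (r m)) f)))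
        y sequentially"
      using that(3) unfolding x_def .
  qed (use that f in auto)
  ultimately show ?thesis by blast
qed

end
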